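(* Let $n\geq 1$ and $\nu\geq1$ be integers, and let $f=(f_1,\ldots,f_\nu):\mathbb{B}_{\ell_\infty^n}\to\mathbb{B}_{\ell_2^\nu}$ be a pluriharmonic function. Then for every $z=(z_1,\dots,z_n)\in\mathbb{B}_{\ell_\infty^n}$, $$\sum_{j=1}^{\nu}\sum_{k=1}^{n}\left(\left|\frac{\partial f_j(z)}{\partial z_k}\right|^2+\left|\frac{\partial f_j(z)}{\partial\overline{z}_k}\right|^2\right)(1-|z_k|^2)^2\leq 1-\|f(z)\|_2^2\qquad(\ast)$$ and $$\sum_{j=1}^{\nu}\sum_{k=1}^{n}\left(\left|\frac{\partial f_j(z)}{\partial z_k}\right|^2+\left|\frac{\partial f_j(z)}{\partial\overline{z}_k}\right|^2\right)\leq\frac{1-\|f(z)\|_2^2}{(1-\|z\|_\infty^2)^2}.$$ Moreover, inequality $(\ast)$ is sharp for each $z\in\mathbb{B}_{\ell_\infty^n}$ (that is, for each $z$ there is such an $f$ for which equality holds in $(\ast)$ at $z$).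
   Context: $\|z\|_2=(\sum_j|z_j|^2)^{1/2}$, $\|z\|_\infty=\max_j|z_j|$. $\mathbb{B}_{\ell_\infty^n}=\{z\in\mathbb{C}^n:\|z\|_\infty<1\}$ is the unit polydisc and $\mathbb{B}_{\ell_2^\nu}=\{w\in\mathbb{C}^\nu:\|w\|_2<1\}$. A twice continuously differentiable complex-valued function $f$ on a domain $\Omega\subset\mathbb{C}^n$ is pluriharmonic if for each fixed $z\in\Omega$ and $\theta\in\mathbb{C}^n$ with $\|\theta\|_2=1$, the function $\zeta\mapsto f(z+\zeta\theta)$ is harmonic in $\{\zeta\in\mathbb{C}:|\zeta|<d_\Omega(z)\}$, where $d_\Omega(z)$ is the Euclidean distance from $z$ to $\partial\Omega$; a vector-valued map is pluriharmonic if each component is. $\partial/\partial z_k$, $\partial/\partial\overline z_k$ are the Wirtinger derivatives. *)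

theory Defs
  imports "HOL-Analysis.Analysis"
begin

text \<open>On \<open>complex ^ 'n\<close> the library's \<open>norm\<close> and \<open>dist\<close> are the Euclidean ones, so
  \<open>ball 0 1\<close> is the Euclidean unit ball of the complex space of dimension \<open>CARD('n)\<close>.\<close>

definition linf_norm :: "complex ^ 'n \<Rightarrow> real" where
  "linf_norm z = Max (range (\<lambda>j. cmod (z $ j)))"

definition polydisc :: "(complex ^ 'n) set" where
  "polydisc = {z. linf_norm z < 1}"

text \<open>Twice continuously differentiable in the real sense.\<close>

definition C2_on :: "('a::real_normed_vector \<Rightarrow> 'b::real_normed_vector) \<Rightarrow> 'a set \<Rightarrow> bool" where
  "C2_on f S \<longleftrightarrow> open S \<and>
     (\<exists>(f' :: 'a \<Rightarrow> ('a \<Rightarrow>\<^sub>L 'b)) (f'' :: 'a \<Rightarrow> ('a \<Rightarrow>\<^sub>L ('a \<Rightarrow>\<^sub>L 'b))).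
        (\<forall>x\<in>S. (f has_derivative blinfun_apply (f' x)) (at x)) \<and>
        (\<forall>x\<in>S. (f' has_derivative blinfun_apply (f'' x)) (at x)) \<and>
        continuous_on S f'')"

definition dir_deriv ::
  "('a::real_normed_vector \<Rightarrow> 'b::real_normed_vector) \<Rightarrow> 'a \<Rightarrow> 'a \<Rightarrow> 'b" where
  "dir_deriv f v x = vector_derivative (\<lambda>t::real. f (x + t *\<^sub>R v)) (at 0)"

text \<open>The directions \<open>1\<close> and \<open>\<i>\<close> are the real coordinate directions of the plane, so
  the second condition is Laplace's equation.\<close>

definition harmonic_on :: "(complex \<Rightarrow> complex) \<Rightarrow> complex set \<Rightarrow> bool" where
  "harmonic_on g U \<longleftrightarrow> C2_on g U \<and>
     (\<forall>\<zeta>\<in>U. dir_deriv (dir_deriv g 1) 1 \<zeta> + dir_deriv (dir_deriv g \<i>) \<i> \<zeta> = 0)"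

text \<open>Extended-real valued, so that the distance to an empty boundary is \<open>\<infinity>\<close>
  (\<open>infdist\<close> would give \<open>0\<close>).\<close>

definition boundary_dist :: "'a::metric_space set \<Rightarrow> 'a \<Rightarrow> ereal" where
  "boundary_dist \<Omega> z = (INF w\<in>frontier \<Omega>. ereal (dist z w))"

definition pluriharmonic_on :: "(complex ^ 'n \<Rightarrow> complex) \<Rightarrow> (complex ^ 'n) set \<Rightarrow> bool" where
  "pluriharmonic_on f \<Omega> \<longleftrightarrow>
     open \<Omega> \<and> connected \<Omega> \<and> \<Omega> \<noteq> {} \<and> C2_on f \<Omega> \<and>
     (\<forall>z\<in>\<Omega>. \<forall>\<theta>. norm \<theta> = 1 \<longrightarrow>
        harmonic_on (\<lambda>\<zeta>. f (z + \<zeta> *s \<theta>)) {\<zeta>. ereal (cmod \<zeta>) < boundary_dist \<Omega> z})"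

definition pluriharmonic_map_on ::
  "(complex ^ 'n \<Rightarrow> complex ^ 'm) \<Rightarrow> (complex ^ 'n) set \<Rightarrow> bool" where
  "pluriharmonic_map_on f \<Omega> \<longleftrightarrow> (\<forall>j. pluriharmonic_on (\<lambda>z. f z $ j) \<Omega>)"

text \<open>With \<open>z\<^sub>k = x\<^sub>k + \<i> y\<^sub>k\<close>, the directions of \<open>x\<^sub>k\<close> and \<open>y\<^sub>k\<close> are \<open>axis k 1\<close> and
  \<open>axis k \<i>\<close>.\<close>

definition wirtinger :: "'n \<Rightarrow> (complex ^ 'n \<Rightarrow> complex) \<Rightarrow> complex ^ 'n \<Rightarrow> complex" where
  "wirtinger k f z = (dir_deriv f (axis k 1) z - \<i> * dir_deriv f (axis k \<i>) z) / 2"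

definition wirtinger_bar :: "'n \<Rightarrow> (complex ^ 'n \<Rightarrow> complex) \<Rightarrow> complex ^ 'n \<Rightarrow> complex" where
  "wirtinger_bar k f z = (dir_deriv f (axis k 1) z + \<i> * dir_deriv f (axis k \<i>) z) / 2"

end

theory Submission
  imports Defs "HOL-Complex_Analysis.Riemann_Mapping"
begin

text \<open>
  Fix \<open>z\<close> in the polydisc and signs \<open>\<epsilon>\<^sub>k = \<plusminus>1\<close>, and put \<open>\<gamma>\<^sub>k(\<zeta>) = (\<epsilon>\<^sub>k \<zeta> + z\<^sub>k) / (1 + cnj z\<^sub>k \<epsilon>\<^sub>k \<zeta>)\<close>.
  This is a holomorphic disc in the polydisc with \<open>\<gamma> 0 = z\<close> and \<open>\<gamma>\<^sub>k' 0 = \<epsilon>\<^sub>k (1 - \<bar>z\<^sub>k\<bar>\<^sup>2)\<close>, and along it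
  each component of \<open>f\<close> is a harmonic function of one variable: the Laplace equations on complex lines
  say that the second derivative satisfies \<open>f''(v, v) + f''(\<i>v, \<i>v) = 0\<close>, and the chain rule adds
  to this only \<open>f'(\<gamma>'') + f'(\<i>\<^sup>2 \<gamma>'') = 0\<close>. Hence \<open>f\<^sub>j \<circ> \<gamma> = h\<^sub>j + cnj k\<^sub>j\<close> with \<open>h\<^sub>j\<close>, \<open>k\<^sub>j\<close> holomorphic on the
  unit disc (\<open>pluriharmonic_along_holomorphic_curve\<close>).

  On the circle of radius \<open>r < 1\<close>, the numbers \<open>f\<^sub>j z\<close>, \<open>r h\<^sub>j' 0\<close> and \<open>r cnj (k\<^sub>j' 0)\<close> are Fourier coefficients of
  \<open>f\<^sub>j \<circ> \<gamma>\<close>. Bessel's inequality, summed over \<open>j\<close>, and \<open>r \<rightarrow> 1\<close> give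
  \<open>\<parallel>f z\<parallel>\<^sup>2 + (\<Sum>\<^sub>j \<bar>h\<^sub>j' 0\<bar>\<^sup>2 + \<bar>k\<^sub>j' 0\<bar>\<^sup>2) \<le> 1\<close> (\<open>harmonic_map_disc_estimate\<close>).

  By the chain rule, \<open>h\<^sub>j' 0 = (\<Sum>\<^sub>k \<epsilon>\<^sub>k (1 - \<bar>z\<^sub>k\<bar>\<^sup>2) \<partial>\<^sub>k f\<^sub>j)\<close>, and \<open>k\<^sub>j' 0\<close> is the conjugate of the same sum of
  the derivatives in the conjugate variables. So the left-hand side of the first inequality is \<open>\<Sum>\<^sub>k \<parallel>X\<^sub>k\<parallel>\<^sup>2\<close> for
  vectors \<open>X\<^sub>k\<close> of which \<open>\<parallel>\<Sum>\<^sub>k \<epsilon>\<^sub>k X\<^sub>k\<parallel>\<^sup>2\<close> has been bounded for every choice of signs, and some choice makes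
  the second number at least as large as the first (\<open>exists_signs_sum_norm_le\<close>).

  The second inequality follows because \<open>1 - \<bar>z\<^sub>k\<bar>\<^sup>2 \<ge> 1 - \<parallel>z\<parallel>\<^sub>\<infinity>\<^sup>2\<close>. Equality in the first holds for a map with
  one nonzero component, the disc automorphism \<open>(w\<^sub>l - z\<^sub>l) / (1 - cnj z\<^sub>l w\<^sub>l)\<close> in one coordinate: it
  vanishes at \<open>z\<close> and is extremal in the classical Schwarz--Pick lemma.
\<close>

section \<open>Symmetry of the second derivative\<close>

text \<open>The difference is the increment over \<open>s \<in> {0..1}\<close> of
  \<open>f (x + s h u + h v) - f (x + s h u)\<close>, less \<open>s h\<^sup>2 f''(v, u)\<close>. Its derivative in \<open>s\<close> is controlled by the
  linear approximation of \<open>f'\<close> near \<open>x\<close>, so the mean value inequality applies.\<close>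

lemma second_difference_estimate:
  fixes f :: "'a::real_normed_vector \<Rightarrow> 'b::real_normed_vector"
  assumes "open S" "x \<in> S"
    and f': "\<And>y. y \<in> S \<Longrightarrow> (f has_derivative blinfun_apply (f' y)) (at y)"
    and f'': "(f' has_derivative blinfun_apply f'') (at x)"
    and "e > 0"
  shows "\<exists>d>0. \<forall>h. 0 < h \<and> h < d \<longrightarrow>
     norm (f (x + h *\<^sub>R u + h *\<^sub>R v) - f (x + h *\<^sub>R u) - f (x + h *\<^sub>R v) + f x
           - h\<^sup>2 *\<^sub>R f'' v u) \<le> e * h\<^sup>2"
proof -
  define K where "K = norm u + norm v + 1"
  have K: "K > 0" "norm u \<le> K" unfolding K_def using norm_ge_zero[of u] norm_ge_zero[of v] by linarith+
  \<comment> \<open>The derivative of \<open>\<psi>\<close> below comes out at most \<open>2 * (e1 * h * K) * (h * K)\<close>, which is \<open>e * h\<^sup>2\<close>.\<close>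
  define e1 where "e1 = e / (2 * K\<^sup>2)"
  have "e1 > 0" using K \<open>e > 0\<close> by (simp add: e1_def)
  then obtain d1 where d1: "d1 > 0"
      "\<And>y. norm (y - x) < d1 \<Longrightarrow> norm (f' y - f' x - f'' (y - x)) \<le> e1 * norm (y - x)"
    using f'' unfolding has_derivative_at_alt by blast
  obtain d2 where d2: "d2 > 0" "ball x d2 \<subseteq> S"
    using assms open_contains_ball by blast
  show ?thesis
  proof (intro exI[of _ "min d1 d2 / K"] conjI allI impI)
    show "min d1 d2 / K > 0" using d1 d2 K by simp
    fix h :: real assume h: "0 < h \<and> h < min d1 d2 / K"
    then have hK: "h * K < d1" "h * K < d2" using K by (auto simp: field_simps)
    define \<psi> where "\<psi> s = f (x + (s * h) *\<^sub>R u + h *\<^sub>R v) - f (x + (s * h) *\<^sub>R u) - (s * h\<^sup>2) *\<^sub>R f'' v u" for s :: real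
    define \<psi>' where "\<psi>' s = f' (x + (s * h) *\<^sub>R u + h *\<^sub>R v) (h *\<^sub>R u) - f' (x + (s * h) *\<^sub>R u) (h *\<^sub>R u)
        - h\<^sup>2 *\<^sub>R f'' v u" for s :: real
    have near: "norm ((s * h) *\<^sub>R u + c *\<^sub>R v) \<le> h * K" if "s \<in> {0..1}" "c \<in> {0, h}" for s c :: real
    proof -
      have "norm ((s * h) *\<^sub>R u) \<le> h * norm u"
        using that h by (auto simp: intro!: mult_right_mono mult_left_le_one_le)
      moreover have "norm (c *\<^sub>R v) \<le> h * norm v" using that h by auto
      ultimately have "norm ((s * h) *\<^sub>R u + c *\<^sub>R v) \<le> h * norm u + h * norm v"
        by (rule norm_triangle_mono)
      also have "\<dots> \<le> h * K" using h by (simp add: K_def algebra_simps)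
      finally show ?thesis .
    qed
    have inS: "x + (s * h) *\<^sub>R u + c *\<^sub>R v \<in> S" if "s \<in> {0..1}" "c \<in> {0, h}" for s c :: real
    proof -
      have "dist (x + ((s * h) *\<^sub>R u + c *\<^sub>R v)) x < d2"
        using near[OF that] hK by (simp add: dist_norm del: scaleR_scaleR)
      then show ?thesis using d2 by (auto simp: add.assoc dist_commute)
    qed
    have der: "(\<psi> has_vector_derivative \<psi>' s) (at s within {0..1})" if s: "s \<in> {0..1}" for s
    proof -
      have 1: "((\<lambda>s. f (x + (s * h) *\<^sub>R u + c *\<^sub>R v)) has_derivative
            (\<lambda>t. f' (x + (s * h) *\<^sub>R u + c *\<^sub>R v) ((t * h) *\<^sub>R u))) (at s within {0..1})"
        if "c \<in> {0, h}" for c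
        by (rule has_derivative_compose[where g = f and f = "\<lambda>s. x + (s * h) *\<^sub>R u + c *\<^sub>R v", OF _ f'[OF inS[OF s that]]])
          (auto intro!: derivative_eq_intros)
      show ?thesis
        unfolding has_vector_derivative_def \<psi>_def \<psi>'_def
        using 1[of h] 1[of 0]
        by (auto intro!: derivative_eq_intros simp: scaleR_diff_right blinfun.scaleR_right)
    qed
    have bd: "norm (\<psi>' s) \<le> e * h\<^sup>2" if s: "s \<in> {0..1}" for s
    proof -
      have E: "norm (f' (x + (s * h) *\<^sub>R u + c *\<^sub>R v) - f' x - f'' ((s * h) *\<^sub>R u + c *\<^sub>R v)) \<le> e1 * (h * K)"
        if "c \<in> {0, h}" for c
      proof -
        have "norm (f' (x + ((s * h) *\<^sub>R u + c *\<^sub>R v)) - f' x - f'' ((s * h) *\<^sub>R u + c *\<^sub>R v)) \<le> e1 * norm ((s * h) *\<^sub>R u + c *\<^sub>R v)"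
          using d1(2)[of "x + ((s * h) *\<^sub>R u + c *\<^sub>R v)"] near[OF s that] hK by simp
        also have "\<dots> \<le> e1 * (h * K)" using near[OF s that] \<open>e1 > 0\<close> by simp
        finally show ?thesis by (simp add: add.assoc)
      qed
      let ?P = "f' (x + (s * h) *\<^sub>R u + h *\<^sub>R v) - f' x - f'' ((s * h) *\<^sub>R u + h *\<^sub>R v)"
      let ?Q = "f' (x + (s * h) *\<^sub>R u) - f' x - f'' ((s * h) *\<^sub>R u)"
      have eq: "\<psi>' s = (?P - ?Q) (h *\<^sub>R u)"
        by (simp add: \<psi>'_def blinfun.bilinear_simps algebra_simps power2_eq_square)
      have "norm (?P - ?Q) \<le> 2 * (e1 * (h * K))"
        using norm_triangle_ineq4[of ?P ?Q] E[of h] E[of 0] by simp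
      then have "norm (\<psi>' s) \<le> 2 * (e1 * (h * K)) * norm (h *\<^sub>R u)"
        unfolding eq by (meson norm_blinfun order_trans mult_right_mono norm_ge_zero)
      also have "\<dots> \<le> 2 * (e1 * (h * K)) * (h * K)"
        using h K \<open>e1 > 0\<close> by (intro mult_left_mono) auto
      also have "\<dots> = e * h\<^sup>2" using K by (simp add: e1_def power2_eq_square)
      finally show ?thesis .
    qed
    have "norm (\<psi> 1 - \<psi> 0) \<le> e * h\<^sup>2 * norm (1 - 0 :: real)"
      by (rule differentiable_bound[of "{0..1}", OF _ der[unfolded has_vector_derivative_def]])
         (auto intro!: onorm_le mult_left_mono bd simp: mult.commute)
    moreover have "\<psi> 1 - \<psi> 0 = f (x + h *\<^sub>R u + h *\<^sub>R v) - f (x + h *\<^sub>R u) - f (x + h *\<^sub>R v) + f x - h\<^sup>2 *\<^sub>R f'' v u"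
      by (simp add: \<psi>_def)
    ultimately show "norm (f (x + h *\<^sub>R u + h *\<^sub>R v) - f (x + h *\<^sub>R u) - f (x + h *\<^sub>R v) + f x
           - h\<^sup>2 *\<^sub>R f'' v u) \<le> e * h\<^sup>2" by simp
  qed
qed

text \<open>The second difference is symmetric in \<open>u\<close> and \<open>v\<close>, so its two approximations
  \<open>h\<^sup>2 f''(v, u)\<close> and \<open>h\<^sup>2 f''(u, v)\<close> differ by \<open>o(h\<^sup>2)\<close>.\<close>

lemma second_derivative_symmetric:
  fixes f :: "'a::real_normed_vector \<Rightarrow> 'b::real_normed_vector"
  assumes "open S" "x \<in> S"
    and "\<And>y. y \<in> S \<Longrightarrow> (f has_derivative blinfun_apply (f' y)) (at y)"
    and "(f' has_derivative blinfun_apply f'') (at x)"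
  shows "f'' u v = f'' v u"
proof -
  have "norm (f'' v u - f'' u v) \<le> 2 * e" if "e > 0" for e
  proof -
    obtain d1 where d1: "d1 > 0" "\<And>h. 0 < h \<and> h < d1 \<Longrightarrow>
     norm (f (x + h *\<^sub>R u + h *\<^sub>R v) - f (x + h *\<^sub>R u) - f (x + h *\<^sub>R v) + f x
           - h\<^sup>2 *\<^sub>R f'' v u) \<le> e * h\<^sup>2"
      using second_difference_estimate[OF assms \<open>e > 0\<close>, of u v] by blast
    obtain d2 where d2: "d2 > 0" "\<And>h. 0 < h \<and> h < d2 \<Longrightarrow>
     norm (f (x + h *\<^sub>R v + h *\<^sub>R u) - f (x + h *\<^sub>R v) - f (x + h *\<^sub>R u) + f x
           - h\<^sup>2 *\<^sub>R f'' u v) \<le> e * h\<^sup>2"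
      using second_difference_estimate[OF assms \<open>e > 0\<close>, of v u] by blast
    define h where "h = min d1 d2 / 2"
    have h: "0 < h" "h < d1" "h < d2" using d1(1) d2(1) by (auto simp: h_def)
    let ?D = "f (x + h *\<^sub>R u + h *\<^sub>R v) - f (x + h *\<^sub>R u) - f (x + h *\<^sub>R v) + f x"
    have 1: "norm (?D - h\<^sup>2 *\<^sub>R f'' v u) \<le> e * h\<^sup>2" using d1(2) h by blast
    have "f (x + h *\<^sub>R v + h *\<^sub>R u) - f (x + h *\<^sub>R v) - f (x + h *\<^sub>R u) + f x = ?D"
      by (simp add: algebra_simps)
    then have 2: "norm (?D - h\<^sup>2 *\<^sub>R f'' u v) \<le> e * h\<^sup>2" using d2(2)[of h] h by metis
    have "h\<^sup>2 * norm (f'' v u - f'' u v) = norm (h\<^sup>2 *\<^sub>R (f'' v u - f'' u v))" by simp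
    also have "\<dots> = norm ((?D - h\<^sup>2 *\<^sub>R f'' u v) - (?D - h\<^sup>2 *\<^sub>R f'' v u))"
      by (simp add: scaleR_diff_right)
    also have "\<dots> \<le> e * h\<^sup>2 + e * h\<^sup>2"
      using norm_triangle_ineq4 1 2 by (meson add_mono order_trans)
    finally have "h\<^sup>2 * norm (f'' v u - f'' u v) \<le> h\<^sup>2 * (2 * e)" by (simp add: algebra_simps)
    then show ?thesis using h by simp
  qed
  then have "norm (f'' v u - f'' u v) \<le> 0"
    using field_le_epsilon[of "norm (f'' v u - f'' u v)" 0] by (metis add_0 field_sum_of_halves half_gt_zero mult_2)
  then show ?thesis by simp
qed

section \<open>Second derivatives of pluriharmonic functions\<close>

lemma dir_deriv_eq:
  assumes "(f has_derivative D) (at x)"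
  shows "dir_deriv f v x = D v"
proof -
  interpret D: bounded_linear D by (rule has_derivative_bounded_linear[OF assms])
  have "((\<lambda>t. f (x + t *\<^sub>R v)) has_derivative (\<lambda>t. D (t *\<^sub>R v))) (at (0::real))"
    by (rule has_derivative_compose[where g = f]) (auto intro!: derivative_eq_intros simp: assms)
  then show ?thesis
    unfolding dir_deriv_def
    by (intro vector_derivative_at) (simp add: has_vector_derivative_def D.scaleR)
qed

lemma dir_deriv_cong:
  assumes "open S" "x \<in> S" and eq: "\<And>y. y \<in> S \<Longrightarrow> f y = g y"
  shows "dir_deriv f v x = dir_deriv g v x"
proof -
  have "((\<lambda>t::real. x + t *\<^sub>R v) \<longlongrightarrow> x) (nhds 0)"
    by (auto intro!: tendsto_eq_intros filterlim_ident)
  then have "\<forall>\<^sub>F t in nhds (0::real). x + t *\<^sub>R v \<in> S"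
    using assms(1,2) topological_tendstoD by fastforce
  then show ?thesis
    unfolding dir_deriv_def
    by (intro vector_derivative_cong_eq) (auto elim!: eventually_mono simp: eq)
qed

lemma dir_deriv_dir_deriv_eq:
  assumes "open S" "x \<in> S"
    and f': "\<And>y. y \<in> S \<Longrightarrow> (f has_derivative blinfun_apply (f' y)) (at y)"
    and f'': "(f' has_derivative blinfun_apply f'') (at x)"
  shows "dir_deriv (dir_deriv f u) v x = f'' v u"
proof -
  have "dir_deriv (dir_deriv f u) v x = dir_deriv (\<lambda>y. f' y u) v x"
    by (rule dir_deriv_cong[OF assms(1,2)]) (simp add: dir_deriv_eq[OF f'])
  also have "\<dots> = f'' v u"
    by (rule dir_deriv_eq) (auto intro!: derivative_eq_intros f'')
  finally show ?thesis .
qed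

lemma boundary_dist_pos:
  assumes "open \<Omega>" "z \<in> \<Omega>"
  shows "boundary_dist \<Omega> z > 0"
proof -
  obtain e where e: "e > 0" "ball z e \<subseteq> \<Omega>"
    using assms open_contains_ball by blast
  have "ereal e \<le> boundary_dist \<Omega> z"
    unfolding boundary_dist_def
  proof (rule INF_greatest)
    fix w assume "w \<in> frontier \<Omega>"
    then have "w \<notin> \<Omega>" using assms(1) by (simp add: frontier_def interior_open)
    then show "ereal e \<le> ereal (dist z w)" using e by (force simp: not_less[symmetric])
  qed
  then show ?thesis using e(1) by (metis ereal_less(2) less_le_trans)
qed

text \<open>A segment from \<open>z\<close> to a point outside \<open>\<Omega>\<close> meets the boundary, at most as far away as that point.\<close>

lemma boundary_dist_less_imp_mem:
  fixes \<Omega> :: "'a::real_normed_vector set"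
  assumes "z \<in> \<Omega>" "ereal (dist z y) < boundary_dist \<Omega> z"
  shows "y \<in> \<Omega>"
proof (rule ccontr)
  assume "y \<notin> \<Omega>"
  then have "closed_segment z y \<inter> frontier \<Omega> \<noteq> {}"
    using assms(1) by (intro connected_Int_frontier) auto
  then obtain w where w: "w \<in> closed_segment z y" "w \<in> frontier \<Omega>" by blast
  then have "boundary_dist \<Omega> z \<le> ereal (dist z w)"
    unfolding boundary_dist_def by (intro INF_lower)
  also have "dist z w \<le> dist z y"
    using segment_bound(1)[OF w(1)] by (simp add: dist_norm norm_minus_commute)
  finally show False using assms(2) by simp
qed

text \<open>This is Laplace's equation at the centre of a disc around \<open>x\<close> in the complex line of direction \<open>v\<close>;
  the disc is nonempty because \<open>x\<close> has positive distance to the boundary. Homogeneity of degree two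
  extends the equation from unit vectors to all \<open>v\<close>.\<close>

lemma pluriharmonic_second_derivative:
  fixes f :: "complex ^ 'n \<Rightarrow> complex"
  assumes ph: "pluriharmonic_on f \<Omega>" and x: "x \<in> \<Omega>"
    and f': "\<And>y. y \<in> \<Omega> \<Longrightarrow> (f has_derivative blinfun_apply (f' y)) (at y)"
    and f'': "(f' has_derivative blinfun_apply f'') (at x)"
  shows "f'' v v + f'' (\<i> *s v) (\<i> *s v) = 0"
proof -
  have "open \<Omega>" using ph by (simp add: pluriharmonic_on_def)
  have unit: "f'' \<theta> \<theta> + f'' (\<i> *s \<theta>) (\<i> *s \<theta>) = 0" if "norm \<theta> = 1" for \<theta>
  proof -
    let ?g = "\<lambda>\<zeta>. f (x + \<zeta> *s \<theta>)"
    have "(0::complex) \<in> {\<zeta>. ereal (cmod \<zeta>) < boundary_dist \<Omega> x}"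
      using boundary_dist_pos[OF \<open>open \<Omega>\<close> x] by (simp add: zero_ereal_def)
    moreover have "harmonic_on ?g {\<zeta>. ereal (cmod \<zeta>) < boundary_dist \<Omega> x}"
      using ph x that by (simp add: pluriharmonic_on_def)
    ultimately have lap: "dir_deriv (dir_deriv ?g 1) 1 0 + dir_deriv (dir_deriv ?g \<i>) \<i> 0 = 0"
      unfolding harmonic_on_def by blast
    have slice: "x + (\<zeta> + t *\<^sub>R u) *s \<theta> = (x + \<zeta> *s \<theta>) + t *\<^sub>R (u *s \<theta>)" for \<zeta> u t
      by (simp add: vec_eq_iff algebra_simps)
    have "dir_deriv (dir_deriv ?g u) u 0 = f'' (u *s \<theta>) (u *s \<theta>)" for u
      using dir_deriv_dir_deriv_eq[OF \<open>open \<Omega>\<close> x f' f'', of "u *s \<theta>" "u *s \<theta>"]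
      unfolding dir_deriv_def slice by simp
    then show ?thesis using lap by simp
  qed
  show ?thesis
  proof (cases "v = 0")
    case False
    define \<theta> where "\<theta> = v /\<^sub>R norm v"
    have v: "v = norm v *\<^sub>R \<theta>" "\<i> *s v = norm v *\<^sub>R (\<i> *s \<theta>)" and "norm \<theta> = 1"
      using False by (auto simp: \<theta>_def vec_eq_iff)
    have "f'' v v + f'' (\<i> *s v) (\<i> *s v) = (norm v)\<^sup>2 *\<^sub>R (f'' \<theta> \<theta> + f'' (\<i> *s \<theta>) (\<i> *s \<theta>))"
    proof -
      have "f'' v v = f'' (norm v *\<^sub>R \<theta>) (norm v *\<^sub>R \<theta>)" using v(1) by metis
      then show ?thesis
        unfolding v(2) by (simp add: blinfun.scaleR_left blinfun.scaleR_right power2_eq_square scaleR_add_right)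
    qed
    then show ?thesis using unit[OF \<open>norm \<theta> = 1\<close>] by simp
  qed (simp add: blinfun.bilinear_simps)
qed

section \<open>Harmonic functions of one complex variable\<close>

text \<open>A real-linear map \<open>T\<close> of the plane is multiplication by \<open>T 1\<close> as soon as \<open>T \<i> = \<i> T 1\<close>.\<close>

lemma has_field_derivative_if_cauchy_riemann:
  fixes P :: "complex \<Rightarrow> complex"
  assumes "(P has_derivative T) (at \<zeta>)" "T \<i> = \<i> * T 1"
  shows "(P has_field_derivative T 1) (at \<zeta>)"
proof -
  interpret T: bounded_linear T by (rule has_derivative_bounded_linear[OF assms(1)])
  have mult: "Re v *\<^sub>R t + Im v *\<^sub>R (\<i> * t) = t * v" for v t
    by (simp add: complex_eq_iff algebra_simps)
  have lin: "T v = T 1 * v" for v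
  proof -
    have v: "v = Re v *\<^sub>R 1 + Im v *\<^sub>R \<i>" by (simp add: complex_eq_iff)
    have "T v = Re v *\<^sub>R T 1 + Im v *\<^sub>R (\<i> * T 1)"
      by (subst v) (simp only: T.add T.scaleR assms(2))
    then show ?thesis by (simp only: mult)
  qed
  have "(P has_derivative (*) (T 1)) (at \<zeta>)"
    by (rule has_derivative_eq_rhs[OF assms(1)]) (rule ext, rule lin)
  then show ?thesis by (simp add: has_field_derivative_def)
qed

text \<open>Here \<open>A\<close> and \<open>B\<close> are the partial derivatives of \<open>g\<close> along the real and the imaginary
  axis, so that \<open>curl\<close> is the equality of mixed derivatives and \<open>laplace\<close> is Laplace's equation.
  Together they are the Cauchy--Riemann equations for \<open>(A - \<i> B) / 2\<close> and for the conjugate of \<open>(A + \<i> B) / 2\<close>.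
  Their primitives on the convex set are \<open>h\<close> and \<open>k\<close>: the derivative of \<open>g - h - cnj k\<close> vanishes.\<close>

lemma harmonic_decomposition:
  fixes g A B :: "complex \<Rightarrow> complex"
  assumes D: "open D" "convex D"
    and g: "\<And>\<zeta>. \<zeta> \<in> D \<Longrightarrow> (g has_derivative (\<lambda>v. Re v *\<^sub>R A \<zeta> + Im v *\<^sub>R B \<zeta>)) (at \<zeta>)"
    and A: "\<And>\<zeta>. \<zeta> \<in> D \<Longrightarrow> (A has_derivative A' \<zeta>) (at \<zeta>)"
    and B: "\<And>\<zeta>. \<zeta> \<in> D \<Longrightarrow> (B has_derivative B' \<zeta>) (at \<zeta>)"
    and curl: "\<And>\<zeta>. \<zeta> \<in> D \<Longrightarrow> A' \<zeta> \<i> = B' \<zeta> 1"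
    and laplace: "\<And>\<zeta>. \<zeta> \<in> D \<Longrightarrow> B' \<zeta> \<i> = - A' \<zeta> 1"
  obtains h k where
    "\<And>\<zeta>. \<zeta> \<in> D \<Longrightarrow> (h has_field_derivative (A \<zeta> - \<i> * B \<zeta>) / 2) (at \<zeta>)"
    "\<And>\<zeta>. \<zeta> \<in> D \<Longrightarrow> (k has_field_derivative cnj (A \<zeta> + \<i> * B \<zeta>) / 2) (at \<zeta>)"
    "\<And>\<zeta>. \<zeta> \<in> D \<Longrightarrow> g \<zeta> = h \<zeta> + cnj (k \<zeta>)"
proof -
  have "(\<lambda>\<zeta>. (A \<zeta> - \<i> * B \<zeta>) / 2) holomorphic_on D"
    unfolding holomorphic_on_open[OF D(1)]
  proof (intro ballI)
    fix \<zeta> assume \<zeta>: "\<zeta> \<in> D"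
    have "((\<lambda>\<zeta>. (A \<zeta> - \<i> * B \<zeta>) / 2) has_derivative (\<lambda>v. (A' \<zeta> v - \<i> * B' \<zeta> v) / 2)) (at \<zeta>)"
      by (auto intro!: derivative_eq_intros A B \<zeta> simp: field_simps)
    from has_field_derivative_if_cauchy_riemann[OF this]
    show "\<exists>f'. ((\<lambda>\<zeta>. (A \<zeta> - \<i> * B \<zeta>) / 2) has_field_derivative f') (at \<zeta>)"
      using curl[OF \<zeta>] laplace[OF \<zeta>] by (auto simp: field_simps)
  qed
  from holomorphic_convex_primitive'[OF D(2,1) this]
  obtain h where h: "\<And>\<zeta>. \<zeta> \<in> D \<Longrightarrow> (h has_field_derivative (A \<zeta> - \<i> * B \<zeta>) / 2) (at \<zeta>)"
    using D(1) by (metis at_within_open)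
  have "(\<lambda>\<zeta>. cnj (A \<zeta> + \<i> * B \<zeta>) / 2) holomorphic_on D"
    unfolding holomorphic_on_open[OF D(1)]
  proof (intro ballI)
    fix \<zeta> assume \<zeta>: "\<zeta> \<in> D"
    have "((\<lambda>\<zeta>. (A \<zeta> + \<i> * B \<zeta>) / 2) has_derivative (\<lambda>v. (A' \<zeta> v + \<i> * B' \<zeta> v) / 2)) (at \<zeta>)"
      by (auto intro!: derivative_eq_intros A B \<zeta> simp: field_simps)
    from bounded_linear.has_derivative[OF bounded_linear_cnj this]
    have "((\<lambda>\<zeta>. cnj (A \<zeta> + \<i> * B \<zeta>) / 2) has_derivative (\<lambda>v. cnj (A' \<zeta> v + \<i> * B' \<zeta> v) / 2)) (at \<zeta>)"
      by simp
    from has_field_derivative_if_cauchy_riemann[OF this]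
    show "\<exists>f'. ((\<lambda>\<zeta>. cnj (A \<zeta> + \<i> * B \<zeta>) / 2) has_field_derivative f') (at \<zeta>)"
      using curl[OF \<zeta>] laplace[OF \<zeta>] by (auto simp: field_simps)
  qed
  from holomorphic_convex_primitive'[OF D(2,1) this]
  obtain k where k: "\<And>\<zeta>. \<zeta> \<in> D \<Longrightarrow> (k has_field_derivative cnj (A \<zeta> + \<i> * B \<zeta>) / 2) (at \<zeta>)"
    using D(1) by (metis at_within_open)
  have "((\<lambda>\<zeta>. g \<zeta> - h \<zeta> - cnj (k \<zeta>)) has_derivative (\<lambda>v. 0)) (at \<zeta> within D)" if \<zeta>: "\<zeta> \<in> D" for \<zeta>
  proof -
    have "((\<lambda>\<zeta>. cnj (k \<zeta>)) has_derivative (\<lambda>v. cnj (cnj (A \<zeta> + \<i> * B \<zeta>) / 2 * v))) (at \<zeta>)"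
      using bounded_linear.has_derivative[OF bounded_linear_cnj k[OF \<zeta>, unfolded has_field_derivative_def]] .
    then have "((\<lambda>\<zeta>. g \<zeta> - h \<zeta> - cnj (k \<zeta>)) has_derivative
        (\<lambda>v. (Re v *\<^sub>R A \<zeta> + Im v *\<^sub>R B \<zeta>) - (A \<zeta> - \<i> * B \<zeta>) / 2 * v - cnj (cnj (A \<zeta> + \<i> * B \<zeta>) / 2 * v))) (at \<zeta>)"
      by (intro has_derivative_diff g[OF \<zeta>] h[OF \<zeta>, unfolded has_field_derivative_def])
    moreover have "(Re v *\<^sub>R A \<zeta> + Im v *\<^sub>R B \<zeta>) - (A \<zeta> - \<i> * B \<zeta>) / 2 * v - cnj (cnj (A \<zeta> + \<i> * B \<zeta>) / 2 * v) = 0" for v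
      by (simp add: complex_eq_iff field_simps)
    ultimately show ?thesis by (simp only: has_derivative_at_withinI)
  qed
  from has_derivative_zero_constant[OF D(2) this]
  obtain c where c: "\<And>\<zeta>. \<zeta> \<in> D \<Longrightarrow> g \<zeta> - h \<zeta> - cnj (k \<zeta>) = c" by blast
  \<comment> \<open>The constant of integration is absorbed into \<open>h\<close>.\<close>
  show ?thesis
  proof (rule that[of "\<lambda>\<zeta>. h \<zeta> + c" k])
    show "((\<lambda>\<zeta>. h \<zeta> + c) has_field_derivative (A \<zeta> - \<i> * B \<zeta>) / 2) (at \<zeta>)" if "\<zeta> \<in> D" for \<zeta>
      using h[OF that] by (auto intro!: derivative_eq_intros)
    show "g \<zeta> = h \<zeta> + c + cnj (k \<zeta>)" if "\<zeta> \<in> D" for \<zeta>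
      using c[OF that] by (simp add: algebra_simps)
  qed (rule k)
qed

section \<open>Bessel's inequality on circles\<close>

lemma continuous_on_circlepath_compose:
  assumes "continuous_on (ball 0 1) F" "0 < r" "r < 1"
  shows "continuous_on T (\<lambda>t. F (circlepath 0 r t))"
proof (rule continuous_on_compose2[OF assms(1)])
  show "continuous_on T (circlepath 0 r)" unfolding circlepath by (intro continuous_intros)
  show "circlepath 0 r ` T \<subseteq> ball 0 1" using assms(2,3) by (auto simp: circlepath norm_mult)
qed

text \<open>Cauchy's formulas for \<open>h 0\<close> and \<open>h' 0\<close>, rewritten with \<open>d\<zeta> = 2\<pi>\<i>\<zeta> dt\<close> and \<open>1/\<zeta> = cnj \<zeta> / r\<^sup>2\<close>
  on the circle. The third integral is the mean of \<open>\<zeta> h \<zeta>\<close>, which vanishes at \<open>0\<close>.\<close>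

lemma circle_coefficients:
  assumes hol: "h holomorphic_on ball 0 1" and r: "0 < r" "r < 1"
  shows "((\<lambda>t. h (circlepath 0 r t)) has_integral h 0) {0..1}"
    and "((\<lambda>t. h (circlepath 0 r t) * cnj (circlepath 0 r t)) has_integral of_real (r\<^sup>2) * deriv h 0) {0..1}"
    and "((\<lambda>t. h (circlepath 0 r t) * circlepath 0 r t) has_integral 0) {0..1}"
proof -
  let ?c = "circlepath 0 r"
  have norm_c: "cmod (?c t) = r" for t using r by (simp add: circlepath norm_mult)
  have c: "?c t \<noteq> 0" "?c t * cnj (?c t) = of_real (r\<^sup>2)" for t
    using norm_c[of t] r by (auto simp only: norm_zero complex_norm_square[symmetric])
  have vd: "vector_derivative ?c (at t) = 2 * pi * \<i> * ?c t" for t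
    unfolding vector_derivative_circlepath by (simp add: circlepath)
  have M: "((\<lambda>t. F (?c t)) has_integral F 0) {0..1}"
    and N: "((\<lambda>t. F (?c t) * cnj (?c t)) has_integral of_real (r\<^sup>2) * deriv F 0) {0..1}"
    if F: "F holomorphic_on ball 0 1" for F
  proof -
    have "ball 0 r \<subseteq> (ball 0 1 :: complex set)" "cball 0 r \<subseteq> (ball 0 1 :: complex set)"
      using r by auto
    then have F': "F holomorphic_on ball 0 r" "continuous_on (cball 0 r) F"
      using F holomorphic_on_subset holomorphic_on_imp_continuous_on by blast+
    have "((\<lambda>u. F u / (u-0)) has_contour_integral (2 * of_real pi * \<i> * F 0)) (circlepath 0 r)"
      using r by (intro Cauchy_integral_circlepath F') auto
    then have "((\<lambda>t. F (?c t) / ?c t * (2 * pi * \<i> * ?c t)) has_integral (2 * of_real pi * \<i> * F 0)) {0..1}"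
      by (simp add: has_contour_integral vd)
    from has_integral_mult_right[OF this, of "1 / (2 * pi * \<i>)"]
    show "((\<lambda>t. F (?c t)) has_integral F 0) {0..1}" using c(1) by simp
    have "((\<lambda>u. F u / (u-0) ^ Suc 1) has_contour_integral (2 * pi) * \<i> / fact 1 * (deriv ^^ 1) F 0) (circlepath 0 r)"
      using r by (intro Cauchy_has_contour_integral_higher_derivative_circlepath F') auto
    then have "((\<lambda>t. F (?c t) / (?c t * ?c t) * (2 * pi * \<i> * ?c t)) has_integral (2 * of_real pi * \<i> * deriv F 0)) {0..1}"
      by (simp add: has_contour_integral vd)
    from has_integral_mult_right[OF this, of "of_real (r\<^sup>2) / (2 * pi * \<i>)"]
    have "((\<lambda>t. F (?c t) * (of_real (r\<^sup>2) / ?c t)) has_integral of_real (r\<^sup>2) * deriv F 0) {0..1}"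
      using c(1) by (simp add: mult_ac)
    moreover have "of_real (r\<^sup>2) / ?c t = cnj (?c t)" for t
      unfolding c(2)[of t, symmetric] using c(1) by simp
    ultimately show "((\<lambda>t. F (?c t) * cnj (?c t)) has_integral of_real (r\<^sup>2) * deriv F 0) {0..1}" by (simp only:)
  qed
  show "((\<lambda>t. h (?c t)) has_integral h 0) {0..1}"
    and "((\<lambda>t. h (?c t) * cnj (?c t)) has_integral of_real (r\<^sup>2) * deriv h 0) {0..1}"
    using M N hol by auto
  show "((\<lambda>t. h (?c t) * ?c t) has_integral 0) {0..1}"
    using M[OF holomorphic_on_mult[OF hol holomorphic_on_ident]] by simp
qed

text \<open>The pairing of \<open>h + cnj k\<close> on the circle with a trigonometric polynomial of degree one sees only
  the Taylor coefficients of order at most one.\<close>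

lemma harmonic_circle_pairing:
  assumes hol: "h holomorphic_on ball 0 1" "k holomorphic_on ball 0 1" and r: "0 < r" "r < 1"
  shows "((\<lambda>t. (h (circlepath 0 r t) + cnj (k (circlepath 0 r t))) * (\<alpha> + \<beta> * cnj (circlepath 0 r t) + \<delta> * circlepath 0 r t))
    has_integral \<alpha> * (h 0 + cnj (k 0)) + of_real (r\<^sup>2) * (\<beta> * deriv h 0 + \<delta> * cnj (deriv k 0))) {0..1}"
proof -
  let ?c = "circlepath 0 r"
  note H = circle_coefficients[OF hol(1) r] and K = circle_coefficients[OF hol(2) r]
  have cnjI: "((\<lambda>t. cnj (F t)) has_integral cnj I) {0..1}" if "(F has_integral I) {0..1}" for F and I :: complex
    using has_integral_linear[OF that bounded_linear_cnj] by (simp add: o_def)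
  have "((\<lambda>t. \<alpha> * h (?c t) + \<beta> * (h (?c t) * cnj (?c t)) + \<delta> * (h (?c t) * ?c t)
      + (\<alpha> * cnj (k (?c t)) + \<delta> * cnj (k (?c t) * cnj (?c t)) + \<beta> * cnj (k (?c t) * ?c t)))
    has_integral \<alpha> * h 0 + \<beta> * (of_real (r\<^sup>2) * deriv h 0) + \<delta> * 0
      + (\<alpha> * cnj (k 0) + \<delta> * cnj (of_real (r\<^sup>2) * deriv k 0) + \<beta> * cnj 0)) {0..1}"
    by (intro has_integral_add has_integral_mult_right H K cnjI)
  then show ?thesis by (simp add: algebra_simps)
qed

text \<open>Let \<open>G\<close> be \<open>h + cnj k\<close> on the circle and \<open>cnj q\<close> its projection to the trigonometric polynomials
  of degree one. The pairings of \<open>G\<close> and of \<open>cnj q\<close> with \<open>q\<close> both have integral \<open>S\<close>, the left-hand side;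
  so the left side of \<open>2 Re (G q) - \<bar>q\<bar>\<^sup>2 \<le> \<bar>G\<bar>\<^sup>2\<close> integrates to \<open>2 S - S\<close>.\<close>

lemma harmonic_bessel:
  assumes hol: "h holomorphic_on ball 0 1" "k holomorphic_on ball 0 1" and r: "0 < r" "r < 1"
  shows "(cmod (h 0 + cnj (k 0)))\<^sup>2 + r\<^sup>2 * ((cmod (deriv h 0))\<^sup>2 + (cmod (deriv k 0))\<^sup>2)
    \<le> integral {0..1} (\<lambda>t. (cmod (h (circlepath 0 r t) + cnj (k (circlepath 0 r t))))\<^sup>2)"
proof -
  let ?c = "circlepath 0 r"
  define g0 a b where "g0 = h 0 + cnj (k 0)" and "a = deriv h 0" and "b = deriv k 0"
  define G where "G t = h (?c t) + cnj (k (?c t))" for t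
  define q where "q t = cnj g0 + cnj a * cnj (?c t) + b * ?c t" for t
  define S where "S = (cmod g0)\<^sup>2 + r\<^sup>2 * ((cmod a)\<^sup>2 + (cmod b)\<^sup>2)"
  have S: "complex_of_real S = cnj g0 * g0 + of_real (r\<^sup>2) * (cnj a * a + b * cnj b)"
    unfolding S_def by (simp only: of_real_add of_real_mult complex_norm_square mult_ac)
  have cont: "continuous_on {0..1} G"
    unfolding G_def using hol r
    by (intro continuous_intros continuous_on_circlepath_compose holomorphic_on_imp_continuous_on)
  have GG: "((\<lambda>t. G t * q t) has_integral of_real S) {0..1}"
    using harmonic_circle_pairing[OF hol r, of "cnj g0" "cnj a" b]
    unfolding S G_def q_def g0_def a_def b_def by simp
  \<comment> \<open>\<open>cnj q\<close> is itself the sum of a holomorphic and an antiholomorphic function.\<close>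
  have "((\<lambda>t. ((g0 + a * ?c t) + cnj (b * ?c t)) * q t) has_integral of_real S) {0..1}"
  proof -
    have "deriv (\<lambda>u. g0 + a * u) 0 = a" "deriv (\<lambda>u. b * u) 0 = b"
      by (auto intro!: DERIV_imp_deriv derivative_eq_intros)
    then show ?thesis
      using harmonic_circle_pairing[of "\<lambda>u. g0 + a * u" "\<lambda>u. b * u", OF _ _ r, of "cnj g0" "cnj a" b]
      unfolding S q_def by (simp add: holomorphic_intros)
  qed
  moreover have "(g0 + a * ?c t) + cnj (b * ?c t) = cnj (q t)" for t by (simp add: q_def)
  ultimately have QQ: "((\<lambda>t. cnj (q t) * q t) has_integral of_real S) {0..1}" by simp
  have int: "(\<lambda>t. (cmod (G t))\<^sup>2) integrable_on {0..1}"
    by (intro integrable_continuous_real continuous_intros cont)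
  have "((\<lambda>t. Re (2 * (G t * q t) - cnj (q t) * q t)) has_integral Re (2 * of_real S - of_real S)) {0..1}"
    by (intro has_integral_Re has_integral_diff has_integral_mult_right GG QQ)
  then have "((\<lambda>t. Re (2 * (G t * q t) - cnj (q t) * q t)) has_integral S) {0..1}" by simp
  moreover have "Re (2 * (G t * q t) - cnj (q t) * q t) \<le> (cmod (G t))\<^sup>2" for t
  proof -
    have "0 \<le> (cmod (G t - cnj (q t)))\<^sup>2" by simp
    then show ?thesis unfolding cmod_power2 by (simp add: power2_eq_square algebra_simps)
  qed
  ultimately have "S \<le> integral {0..1} (\<lambda>t. (cmod (G t))\<^sup>2)"
    using has_integral_le[OF _ integrable_integral[OF int]] by blast
  then show ?thesis unfolding S_def G_def g0_def a_def b_def .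
qed

text \<open>Integrate the bound over the circle of radius \<open>r\<close>, use Bessel's inequality in every component, and
  let \<open>r\<close> tend to \<open>1\<close>.\<close>

lemma harmonic_map_disc_estimate:
  fixes h k :: "'m::finite \<Rightarrow> complex \<Rightarrow> complex"
  assumes hol: "\<And>j. h j holomorphic_on ball 0 1" "\<And>j. k j holomorphic_on ball 0 1"
    and bound: "\<And>\<zeta>. \<zeta> \<in> ball 0 1 \<Longrightarrow> (\<Sum>j\<in>UNIV. (cmod (h j \<zeta> + cnj (k j \<zeta>)))\<^sup>2) \<le> 1"
  shows "(\<Sum>j\<in>UNIV. (cmod (h j 0 + cnj (k j 0)))\<^sup>2)
    + (\<Sum>j\<in>UNIV. (cmod (deriv (h j) 0))\<^sup>2 + (cmod (deriv (k j) 0))\<^sup>2) \<le> 1"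
proof -
  let ?u = "\<Sum>j\<in>UNIV. (cmod (h j 0 + cnj (k j 0)))\<^sup>2"
  let ?v = "\<Sum>j\<in>UNIV. (cmod (deriv (h j) 0))\<^sup>2 + (cmod (deriv (k j) 0))\<^sup>2"
  have *: "?u + r\<^sup>2 * ?v \<le> 1" if r: "0 < r" "r < 1" for r
  proof -
    let ?c = "circlepath 0 r"
    have cb: "?c t \<in> ball 0 1" for t using r by (auto simp: circlepath norm_mult)
    have cont: "continuous_on {0..1} (\<lambda>t. (cmod (h j (?c t) + cnj (k j (?c t))))\<^sup>2)" for j
      by (intro continuous_intros continuous_on_circlepath_compose holomorphic_on_imp_continuous_on hol r)
    have "?u + r\<^sup>2 * ?v = (\<Sum>j\<in>UNIV. (cmod (h j 0 + cnj (k j 0)))\<^sup>2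
        + r\<^sup>2 * ((cmod (deriv (h j) 0))\<^sup>2 + (cmod (deriv (k j) 0))\<^sup>2))"
      by (simp add: sum.distrib sum_distrib_left distrib_left)
    also have "\<dots> \<le> (\<Sum>j\<in>UNIV. integral {0..1} (\<lambda>t. (cmod (h j (?c t) + cnj (k j (?c t))))\<^sup>2))"
      by (intro sum_mono harmonic_bessel hol r)
    also have "\<dots> = integral {0..1} (\<lambda>t. \<Sum>j\<in>UNIV. (cmod (h j (?c t) + cnj (k j (?c t))))\<^sup>2)"
      by (intro integral_sum[symmetric] integrable_continuous_real cont) auto
    also have "\<dots> \<le> integral {0..1} (\<lambda>t::real. 1)"
      by (intro integral_le integrable_continuous_real continuous_intros cont bound cb)
    finally show ?thesis by simp
  qed
  have "((\<lambda>r. ?u + r\<^sup>2 * ?v) \<longlongrightarrow> ?u + 1\<^sup>2 * ?v) (at_left (1::real))"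
    by (intro tendsto_intros)
  moreover have "\<forall>\<^sub>F r in at_left (1::real). ?u + r\<^sup>2 * ?v \<le> 1"
    unfolding eventually_at_left_field using * by (intro exI[of _ 0]) auto
  ultimately have "?u + 1\<^sup>2 * ?v \<le> 1"
    by (rule tendsto_upperbound) simp
  then show ?thesis by simp
qed

section \<open>Choice of signs\<close>

text \<open>Add the vectors one at a time, choosing each sign so that the new vector has nonnegative inner
  product with the partial sum; the square of the norm then grows by at least \<open>\<parallel>x\<^sub>i\<parallel>\<^sup>2\<close>.\<close>

lemma exists_signs_sum_norm_le:
  fixes x :: "'k \<Rightarrow> 'a::real_inner"
  assumes "finite S"
  shows "\<exists>\<epsilon>. (\<forall>i. \<epsilon> i \<in> {-1, 1::real}) \<and> (\<Sum>i\<in>S. (norm (x i))\<^sup>2) \<le> (norm (\<Sum>i\<in>S. \<epsilon> i *\<^sub>R x i))\<^sup>2"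
  using assms
proof induction
  case empty
  show ?case by (intro exI[of _ "\<lambda>_. 1"]) auto
next
  case (insert k S)
  then obtain \<epsilon> where \<epsilon>: "\<forall>i. \<epsilon> i \<in> {-1, 1::real}" "(\<Sum>i\<in>S. (norm (x i))\<^sup>2) \<le> (norm (\<Sum>i\<in>S. \<epsilon> i *\<^sub>R x i))\<^sup>2"
    by blast
  define s where "s = (\<Sum>i\<in>S. \<epsilon> i *\<^sub>R x i)"
  define \<sigma> :: real where "\<sigma> = (if s \<bullet> x k \<ge> 0 then 1 else -1)"
  have "(norm (\<sigma> *\<^sub>R x k + s))\<^sup>2 = (norm (x k))\<^sup>2 + 2 * \<bar>s \<bullet> x k\<bar> + (norm s)\<^sup>2"
    by (auto simp: \<sigma>_def power2_norm_eq_inner inner_simps inner_commute abs_if)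
  moreover have "(\<Sum>i\<in>insert k S. (\<epsilon>(k := \<sigma>)) i *\<^sub>R x i) = \<sigma> *\<^sub>R x k + s"
  proof -
    have "(\<Sum>i\<in>S. (\<epsilon>(k := \<sigma>)) i *\<^sub>R x i) = s"
      unfolding s_def using insert.hyps by (intro sum.cong) auto
    then show ?thesis using insert.hyps by simp
  qed
  ultimately show ?case
    using \<epsilon> insert.hyps by (intro exI[of _ "\<epsilon>(k := \<sigma>)"]) (auto simp: s_def[symmetric] \<sigma>_def)
qed

section \<open>Pluriharmonic functions along holomorphic curves\<close>

lemma has_derivative_vec_components:
  fixes \<gamma> :: "'a::real_normed_vector \<Rightarrow> 'b::euclidean_space ^ 'n"
  assumes "\<And>k. ((\<lambda>x. \<gamma> x $ k) has_derivative (\<lambda>v. D v $ k)) (at x)"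
  shows "(\<gamma> has_derivative D) (at x)"
  unfolding has_derivative_componentwise_within[of \<gamma>]
  using assms by (auto simp: Basis_vec_def inner_axis intro!: has_derivative_inner_left)

text \<open>With \<open>A = f'(\<gamma>')\<close> and \<open>B = f'(\<i> \<gamma>')\<close>, the chain rule gives the derivatives
  \<open>f'(w v \<gamma>'') + f''(v \<gamma>', w \<gamma>')\<close> in direction \<open>v\<close>, where \<open>w\<close> is \<open>1\<close> for \<open>A\<close> and \<open>\<i>\<close> for \<open>B\<close>. Equality of the mixed
  derivatives is then the symmetry of \<open>f''\<close>; in the Laplacian the terms with \<open>\<gamma>''\<close> cancel since
  \<open>\<i>\<^sup>2 = -1\<close>, and the others cancel because \<open>f\<close> is pluriharmonic.\<close>

lemma pluriharmonic_along_holomorphic_curve: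
  fixes f :: "complex ^ 'n \<Rightarrow> complex" and \<gamma> :: "complex \<Rightarrow> complex ^ 'n"
  assumes ph: "pluriharmonic_on f \<Omega>"
    and D: "open D" "convex D" and maps: "\<And>\<zeta>. \<zeta> \<in> D \<Longrightarrow> \<gamma> \<zeta> \<in> \<Omega>"
    and hol: "\<And>k. (\<lambda>\<zeta>. \<gamma> \<zeta> $ k) holomorphic_on D"
  defines "\<gamma>' \<equiv> \<lambda>\<zeta>. \<chi> k. deriv (\<lambda>\<zeta>. \<gamma> \<zeta> $ k) \<zeta>"
  obtains h k where
    "\<And>\<zeta>. \<zeta> \<in> D \<Longrightarrow> (h has_field_derivative
       (dir_deriv f (\<gamma>' \<zeta>) (\<gamma> \<zeta>) - \<i> * dir_deriv f (\<i> *s \<gamma>' \<zeta>) (\<gamma> \<zeta>)) / 2) (at \<zeta>)"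
    "\<And>\<zeta>. \<zeta> \<in> D \<Longrightarrow> (k has_field_derivative
       cnj (dir_deriv f (\<gamma>' \<zeta>) (\<gamma> \<zeta>) + \<i> * dir_deriv f (\<i> *s \<gamma>' \<zeta>) (\<gamma> \<zeta>)) / 2) (at \<zeta>)"
    "\<And>\<zeta>. \<zeta> \<in> D \<Longrightarrow> f (\<gamma> \<zeta>) = h \<zeta> + cnj (k \<zeta>)"
proof -
  have "open \<Omega>" "C2_on f \<Omega>" using ph by (auto simp: pluriharmonic_on_def)
  then obtain f' f'' where
    f': "\<And>x. x \<in> \<Omega> \<Longrightarrow> (f has_derivative blinfun_apply (f' x)) (at x)" and
    f'': "\<And>x. x \<in> \<Omega> \<Longrightarrow> (f' has_derivative blinfun_apply (f'' x)) (at x)"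
    unfolding C2_on_def by blast
  define \<gamma>'' where "\<gamma>'' \<zeta> = (\<chi> k. deriv (\<lambda>\<zeta>. \<gamma>' \<zeta> $ k) \<zeta>)" for \<zeta>
  have \<gamma>: "(\<gamma> has_derivative (\<lambda>v. v *s \<gamma>' \<zeta>)) (at \<zeta>)" if "\<zeta> \<in> D" for \<zeta>
    using holomorphic_derivI[OF hol D(1) that]
    by (intro has_derivative_vec_components) (simp add: \<gamma>'_def has_field_derivative_def mult_commute_abs)
  have "(\<lambda>\<zeta>. \<gamma>' \<zeta> $ k) holomorphic_on D" for k
    using holomorphic_deriv[OF hol D(1)] by (simp add: \<gamma>'_def)
  then have "((\<lambda>\<zeta>. \<gamma>' \<zeta> $ k) has_field_derivative \<gamma>'' \<zeta> $ k) (at \<zeta>)" if "\<zeta> \<in> D" for \<zeta> k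
    using holomorphic_derivI[OF _ D(1) that] by (simp add: \<gamma>''_def)
  then have \<gamma>': "((\<lambda>\<zeta>. w *s \<gamma>' \<zeta>) has_derivative (\<lambda>v. (w * v) *s \<gamma>'' \<zeta>)) (at \<zeta>)" if "\<zeta> \<in> D" for \<zeta> w
    using that by (intro has_derivative_vec_components)
      (auto simp: has_field_derivative_def intro!: derivative_eq_intros)
  let ?A = "\<lambda>w \<zeta>. f' (\<gamma> \<zeta>) (w *s \<gamma>' \<zeta>)"
  let ?A' = "\<lambda>w \<zeta> v. f' (\<gamma> \<zeta>) ((w * v) *s \<gamma>'' \<zeta>) + f'' (\<gamma> \<zeta>) (v *s \<gamma>' \<zeta>) (w *s \<gamma>' \<zeta>)"
  have A: "(?A w has_derivative ?A' w \<zeta>) (at \<zeta>)" if \<zeta>: "\<zeta> \<in> D" for w \<zeta>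
  proof -
    have "((\<lambda>\<zeta>. f' (\<gamma> \<zeta>)) has_derivative (\<lambda>v. f'' (\<gamma> \<zeta>) (v *s \<gamma>' \<zeta>))) (at \<zeta>)"
      by (rule has_derivative_compose[OF \<gamma>[OF \<zeta>] f''[OF maps[OF \<zeta>]]])
    from blinfun.FDERIV[OF this \<gamma>'[OF \<zeta>]] show ?thesis .
  qed
  have g: "((\<lambda>\<zeta>. f (\<gamma> \<zeta>)) has_derivative (\<lambda>v. Re v *\<^sub>R ?A 1 \<zeta> + Im v *\<^sub>R ?A \<i> \<zeta>)) (at \<zeta>)"
    if \<zeta>: "\<zeta> \<in> D" for \<zeta>
  proof -
    have comb: "v *s w = Re v *\<^sub>R (1 *s w) + Im v *\<^sub>R (\<i> *s w)" for v and w :: "complex ^ 'n"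
      by (simp add: vec_eq_iff complex_eq_iff)
    have lin: "f' (\<gamma> \<zeta>) (v *s \<gamma>' \<zeta>) = Re v *\<^sub>R ?A 1 \<zeta> + Im v *\<^sub>R ?A \<i> \<zeta>" for v
      by (subst comb) (simp only: blinfun.add_right blinfun.scaleR_right)
    show ?thesis
      by (rule has_derivative_eq_rhs[OF has_derivative_compose[OF \<gamma>[OF \<zeta>] f'[OF maps[OF \<zeta>]]]])
        (rule ext, rule lin)
  qed
  have curl: "?A' 1 \<zeta> \<i> = ?A' \<i> \<zeta> 1" if \<zeta>: "\<zeta> \<in> D" for \<zeta>
  proof -
    have "f'' (\<gamma> \<zeta>) (\<i> *s \<gamma>' \<zeta>) (\<gamma>' \<zeta>) = f'' (\<gamma> \<zeta>) (\<gamma>' \<zeta>) (\<i> *s \<gamma>' \<zeta>)"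
      by (rule second_derivative_symmetric[OF \<open>open \<Omega>\<close> maps[OF \<zeta>] f' f''[OF maps[OF \<zeta>]]])
    then show ?thesis by simp
  qed
  have neg: "(- 1) *s w = - w" for w :: "complex ^ 'n" by (simp add: vec_eq_iff)
  have laplace: "?A' \<i> \<zeta> \<i> = - ?A' 1 \<zeta> 1" if \<zeta>: "\<zeta> \<in> D" for \<zeta>
    using pluriharmonic_second_derivative[OF ph maps[OF \<zeta>] f' f''[OF maps[OF \<zeta>]], of "\<gamma>' \<zeta>"]
    by (simp add: neg blinfun.minus_right eq_neg_iff_add_eq_0 add.commute)
  have dd: "f' (\<gamma> \<zeta>) v = dir_deriv f v (\<gamma> \<zeta>)" if "\<zeta> \<in> D" for \<zeta> v
    using dir_deriv_eq[OF f'[OF maps[OF that]]] by simp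
  show ?thesis
  proof (rule harmonic_decomposition[OF D g A A curl laplace])
    fix h k
    assume "\<And>\<zeta>. \<zeta> \<in> D \<Longrightarrow> (h has_field_derivative (?A 1 \<zeta> - \<i> * ?A \<i> \<zeta>) / 2) (at \<zeta>)"
      and "\<And>\<zeta>. \<zeta> \<in> D \<Longrightarrow> (k has_field_derivative cnj (?A 1 \<zeta> + \<i> * ?A \<i> \<zeta>) / 2) (at \<zeta>)"
      and "\<And>\<zeta>. \<zeta> \<in> D \<Longrightarrow> f (\<gamma> \<zeta>) = h \<zeta> + cnj (k \<zeta>)"
    then show thesis by (intro that[of h k]) (simp_all add: dd)
  qed
qed

section \<open>The inequalities\<close>

lemma mem_polydisc_iff: "z \<in> polydisc \<longleftrightarrow> (\<forall>k. cmod (z $ k) < 1)"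
  by (simp add: polydisc_def linf_norm_def)

lemma norm_vec_power2: "(norm (x :: complex ^ 'm))\<^sup>2 = (\<Sum>j\<in>UNIV. (cmod (x $ j))\<^sup>2)"
  by (simp add: norm_vec_def L2_set_def sum_nonneg)

text \<open>The chain rule at the centre of the disc, where the velocity of the curve is the real vector \<open>c\<close>.\<close>

lemma dir_deriv_real_combination:
  fixes f :: "complex ^ 'n \<Rightarrow> complex" and c :: "'n \<Rightarrow> real"
  assumes "f differentiable (at z)"
  shows "(dir_deriv f (\<chi> k. of_real (c k)) z - \<i> * dir_deriv f (\<i> *s (\<chi> k. of_real (c k))) z) / 2
           = (\<Sum>k\<in>UNIV. c k *\<^sub>R wirtinger k f z)"
    and "(dir_deriv f (\<chi> k. of_real (c k)) z + \<i> * dir_deriv f (\<i> *s (\<chi> k. of_real (c k))) z) / 2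
           = (\<Sum>k\<in>UNIV. c k *\<^sub>R wirtinger_bar k f z)"
proof -
  obtain T where T: "(f has_derivative T) (at z)"
    using assms unfolding differentiable_def by blast
  interpret T: bounded_linear T by (rule has_derivative_bounded_linear[OF T])
  have "w *s (\<chi> k. of_real (c k)) = (\<Sum>k\<in>UNIV. c k *\<^sub>R axis k w)" for w :: complex
    by (simp add: vec_eq_iff axis_def if_distrib[of "\<lambda>x. _ *\<^sub>R x"] cong: if_cong)
      (simp add: scaleR_conv_of_real mult.commute)
  then have dd: "dir_deriv f (w *s (\<chi> k. of_real (c k))) z = (\<Sum>k\<in>UNIV. c k *\<^sub>R dir_deriv f (axis k w) z)" for w
    by (simp add: dir_deriv_eq[OF T] T.sum T.scaleR)
  show "(dir_deriv f (\<chi> k. of_real (c k)) z - \<i> * dir_deriv f (\<i> *s (\<chi> k. of_real (c k))) z) / 2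
           = (\<Sum>k\<in>UNIV. c k *\<^sub>R wirtinger k f z)"
    using dd[of 1] dd[of \<i>]
    by (simp add: wirtinger_def sum_distrib_left sum_subtractf sum_divide_distrib scaleR_conv_of_real algebra_simps diff_divide_distrib)
  show "(dir_deriv f (\<chi> k. of_real (c k)) z + \<i> * dir_deriv f (\<i> *s (\<chi> k. of_real (c k))) z) / 2
           = (\<Sum>k\<in>UNIV. c k *\<^sub>R wirtinger_bar k f z)"
    using dd[of 1] dd[of \<i>]
    by (simp add: wirtinger_bar_def sum_distrib_left sum.distrib sum_divide_distrib scaleR_conv_of_real algebra_simps add_divide_distrib)
qed

lemma deriv_Moebius_function_at_origin: "deriv (Moebius_function 0 (- a)) 0 = of_real (1 - (cmod a)\<^sup>2)"
  unfolding Moebius_function_simple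
  by (rule DERIV_imp_deriv)
    (auto intro!: derivative_eq_intros simp: complex_norm_square simp del: of_real_power)

text \<open>The estimate in one variable along the disc \<open>\<gamma>\<^sub>k(\<zeta>) = (\<epsilon>\<^sub>k \<zeta> + z\<^sub>k) / (1 + cnj z\<^sub>k \<epsilon>\<^sub>k \<zeta>)\<close>, whose velocity at \<open>0\<close>
  is \<open>c\<close>.\<close>

lemma schwarz_pick_signed:
  fixes f :: "complex ^ 'n \<Rightarrow> complex ^ 'm" and \<epsilon> :: "'n \<Rightarrow> real"
  assumes ph: "pluriharmonic_map_on f polydisc" and ball: "f ` polydisc \<subseteq> ball 0 1"
    and z: "z \<in> polydisc" and \<epsilon>: "\<And>k. \<epsilon> k \<in> {-1, 1}"
  defines "c \<equiv> \<lambda>k. \<epsilon> k * (1 - (cmod (z $ k))\<^sup>2)"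
  shows "(\<Sum>j\<in>UNIV. (cmod (\<Sum>k\<in>UNIV. c k *\<^sub>R wirtinger k (\<lambda>w. f w $ j) z))\<^sup>2
       + (cmod (\<Sum>k\<in>UNIV. c k *\<^sub>R wirtinger_bar k (\<lambda>w. f w $ j) z))\<^sup>2) \<le> 1 - (norm (f z))\<^sup>2"
proof -
  let ?D = "ball 0 1 :: complex set"
  define \<gamma> where "\<gamma> \<zeta> = (\<chi> k. Moebius_function 0 (- z $ k) (of_real (\<epsilon> k) * \<zeta>))" for \<zeta>
  have phj: "pluriharmonic_on (\<lambda>w. f w $ j) polydisc" for j
    using ph by (simp add: pluriharmonic_map_on_def)
  have zk: "cmod (- z $ k) < 1" for k using z by (simp add: mem_polydisc_iff)
  have scale: "of_real (\<epsilon> k) * \<zeta> \<in> ?D" if "\<zeta> \<in> ?D" for \<zeta> k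
    using \<epsilon>[of k] that by (auto simp: norm_mult)
  have hol: "(\<lambda>\<zeta>. \<gamma> \<zeta> $ k) holomorphic_on ?D" for k
  proof -
    have "(\<lambda>\<zeta>. of_real (\<epsilon> k) * \<zeta>) holomorphic_on ?D" by (intro holomorphic_intros)
    moreover have "(\<lambda>\<zeta>. of_real (\<epsilon> k) * \<zeta>) ` ?D \<subseteq> ?D" using scale by blast
    ultimately show ?thesis
      using holomorphic_on_compose_gen[OF _ Moebius_function_holomorphic[OF zk]]
      unfolding \<gamma>_def o_def by fastforce
  qed
  have maps: "\<gamma> \<zeta> \<in> polydisc" if "\<zeta> \<in> ?D" for \<zeta>
    using Moebius_function_norm_lt_1[OF zk] scale[OF that] by (simp add: mem_polydisc_iff \<gamma>_def)
  have \<gamma>0: "\<gamma> 0 = z" by (simp add: \<gamma>_def Moebius_function_of_zero vec_eq_iff)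
  have "deriv (\<lambda>\<zeta>. \<gamma> \<zeta> $ k) 0 = of_real (c k)" for k
  proof -
    have "Moebius_function 0 (- z $ k) field_differentiable at (of_real (\<epsilon> k) * 0)"
      by (rule holomorphic_on_imp_differentiable_at[OF Moebius_function_holomorphic[OF zk]]) auto
    then have "deriv (Moebius_function 0 (- z $ k) \<circ> (\<lambda>\<zeta>. of_real (\<epsilon> k) * \<zeta>)) 0
      = deriv (Moebius_function 0 (- z $ k)) (of_real (\<epsilon> k) * 0) * deriv (\<lambda>\<zeta>. of_real (\<epsilon> k) * \<zeta>) 0"
      by (intro deriv_chain) (auto intro!: derivative_intros)
    then show ?thesis
      using deriv_Moebius_function_at_origin[of "z $ k"] by (simp add: \<gamma>_def o_def c_def mult.commute)
  qed
  then have \<gamma>'0: "(\<chi> k. deriv (\<lambda>\<zeta>. \<gamma> \<zeta> $ k) 0) = (\<chi> k. of_real (c k))" by simp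
  have diff: "(\<lambda>w. f w $ j) differentiable (at z)" for j
    using phj[of j] z unfolding pluriharmonic_on_def C2_on_def differentiable_def by blast
  define split where "split j h k \<longleftrightarrow> h holomorphic_on ?D \<and> k holomorphic_on ?D \<and>
      (\<forall>\<zeta>\<in>?D. f (\<gamma> \<zeta>) $ j = h \<zeta> + cnj (k \<zeta>)) \<and>
      deriv h 0 = (\<Sum>k\<in>UNIV. c k *\<^sub>R wirtinger k (\<lambda>w. f w $ j) z) \<and>
      deriv k 0 = cnj (\<Sum>k\<in>UNIV. c k *\<^sub>R wirtinger_bar k (\<lambda>w. f w $ j) z)" for j h k
  have "\<exists>h k. split j h k" for j
  proof (rule pluriharmonic_along_holomorphic_curve[OF phj[of j] open_ball convex_ball maps hol], assumption)
    fix h k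
    assume h: "\<And>\<zeta>. \<zeta> \<in> ?D \<Longrightarrow> (h has_field_derivative
       (dir_deriv (\<lambda>w. f w $ j) (\<chi> k. deriv (\<lambda>\<zeta>. \<gamma> \<zeta> $ k) \<zeta>) (\<gamma> \<zeta>)
         - \<i> * dir_deriv (\<lambda>w. f w $ j) (\<i> *s (\<chi> k. deriv (\<lambda>\<zeta>. \<gamma> \<zeta> $ k) \<zeta>)) (\<gamma> \<zeta>)) / 2) (at \<zeta>)"
    and k: "\<And>\<zeta>. \<zeta> \<in> ?D \<Longrightarrow> (k has_field_derivative
       cnj (dir_deriv (\<lambda>w. f w $ j) (\<chi> k. deriv (\<lambda>\<zeta>. \<gamma> \<zeta> $ k) \<zeta>) (\<gamma> \<zeta>)
         + \<i> * dir_deriv (\<lambda>w. f w $ j) (\<i> *s (\<chi> k. deriv (\<lambda>\<zeta>. \<gamma> \<zeta> $ k) \<zeta>)) (\<gamma> \<zeta>)) / 2) (at \<zeta>)"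
    and eq: "\<And>\<zeta>. \<zeta> \<in> ?D \<Longrightarrow> f (\<gamma> \<zeta>) $ j = h \<zeta> + cnj (k \<zeta>)"
    have "h holomorphic_on ?D" "k holomorphic_on ?D"
      using h k holomorphic_on_open[OF open_ball] by blast+
    moreover have "deriv h 0 = (\<Sum>k\<in>UNIV. c k *\<^sub>R wirtinger k (\<lambda>w. f w $ j) z)"
      using DERIV_imp_deriv[OF h[of 0]]
      unfolding \<gamma>0 \<gamma>'0 dir_deriv_real_combination[OF diff] by simp
    moreover have "deriv k 0 = cnj ((dir_deriv (\<lambda>w. f w $ j) (\<chi> k. of_real (c k)) z
         + \<i> * dir_deriv (\<lambda>w. f w $ j) (\<i> *s (\<chi> k. of_real (c k))) z) / 2)"
      using DERIV_imp_deriv[OF k[of 0]] unfolding \<gamma>0 \<gamma>'0 by simp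
    ultimately show ?thesis
      using eq unfolding split_def dir_deriv_real_combination[OF diff] by blast
  qed
  then obtain h k where "\<And>j. split j (h j) (k j)" by metis
  then have hk: "\<And>j. h j holomorphic_on ?D" "\<And>j. k j holomorphic_on ?D"
    and eq: "\<And>j \<zeta>. \<zeta> \<in> ?D \<Longrightarrow> f (\<gamma> \<zeta>) $ j = h j \<zeta> + cnj (k j \<zeta>)"
    and h0: "\<And>j. deriv (h j) 0 = (\<Sum>k\<in>UNIV. c k *\<^sub>R wirtinger k (\<lambda>w. f w $ j) z)"
    and k0: "\<And>j. deriv (k j) 0 = cnj (\<Sum>k\<in>UNIV. c k *\<^sub>R wirtinger_bar k (\<lambda>w. f w $ j) z)"
    unfolding split_def by blast+
  have sq: "(\<Sum>j\<in>UNIV. (cmod (h j \<zeta> + cnj (k j \<zeta>)))\<^sup>2) = (norm (f (\<gamma> \<zeta>)))\<^sup>2" if "\<zeta> \<in> ?D" for \<zeta>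
    by (simp add: norm_vec_power2 eq[OF that])
  have "(\<Sum>j\<in>UNIV. (cmod (h j 0 + cnj (k j 0)))\<^sup>2)
    + (\<Sum>j\<in>UNIV. (cmod (deriv (h j) 0))\<^sup>2 + (cmod (deriv (k j) 0))\<^sup>2) \<le> 1"
  proof (rule harmonic_map_disc_estimate[OF hk])
    fix \<zeta> :: complex assume \<zeta>: "\<zeta> \<in> ?D"
    have "norm (f (\<gamma> \<zeta>)) < 1" using ball maps[OF \<zeta>] by (simp add: image_subset_iff)
    then show "(\<Sum>j\<in>UNIV. (cmod (h j \<zeta> + cnj (k j \<zeta>)))\<^sup>2) \<le> 1"
      unfolding sq[OF \<zeta>] by (simp add: power_le_one)
  qed
  moreover have "(\<Sum>j\<in>UNIV. (cmod (h j 0 + cnj (k j 0)))\<^sup>2) = (norm (f z))\<^sup>2"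
    using sq[of 0] by (simp add: \<gamma>0)
  moreover have "(\<Sum>j\<in>UNIV. (cmod (deriv (h j) 0))\<^sup>2 + (cmod (deriv (k j) 0))\<^sup>2)
    = (\<Sum>j\<in>UNIV. (cmod (\<Sum>k\<in>UNIV. c k *\<^sub>R wirtinger k (\<lambda>w. f w $ j) z))\<^sup>2
       + (cmod (\<Sum>k\<in>UNIV. c k *\<^sub>R wirtinger_bar k (\<lambda>w. f w $ j) z))\<^sup>2)"
    unfolding h0 k0 complex_mod_cnj ..
  ultimately show ?thesis by linarith
qed

text \<open>For \<open>X\<^sub>k\<close> with components \<open>(1 - \<bar>z\<^sub>k\<bar>\<^sup>2) \<partial>\<^sub>k f\<^sub>j\<close> and their counterparts in the conjugate variables, the
  left-hand side is \<open>\<Sum>\<^sub>k \<parallel>X\<^sub>k\<parallel>\<^sup>2\<close> and the signed estimate bounds \<open>\<parallel>\<Sum>\<^sub>k \<epsilon>\<^sub>k X\<^sub>k\<parallel>\<^sup>2\<close>.\<close>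

lemma schwarz_pick_weighted:
  fixes f :: "complex ^ 'n \<Rightarrow> complex ^ 'm"
  assumes ph: "pluriharmonic_map_on f polydisc" and ball: "f ` polydisc \<subseteq> ball 0 1"
    and z: "z \<in> polydisc"
  shows "(\<Sum>j\<in>UNIV. \<Sum>k\<in>UNIV.
            ((cmod (wirtinger k (\<lambda>w. f w $ j) z))\<^sup>2
             + (cmod (wirtinger_bar k (\<lambda>w. f w $ j) z))\<^sup>2) * (1 - (cmod (z $ k))\<^sup>2)\<^sup>2)
         \<le> 1 - (norm (f z))\<^sup>2" (is "?L \<le> _")
proof -
  let ?a = "\<lambda>k. 1 - (cmod (z $ k))\<^sup>2"
  let ?w = "\<lambda>k j. wirtinger k (\<lambda>w. f w $ j) z" and ?v = "\<lambda>k j. wirtinger_bar k (\<lambda>w. f w $ j) z"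
  define X :: "'n \<Rightarrow> (complex ^ 'm) \<times> (complex ^ 'm)"
    where "X k = (\<chi> j. ?a k *\<^sub>R ?w k j, \<chi> j. ?a k *\<^sub>R ?v k j)" for k
  obtain \<epsilon> where \<epsilon>: "\<And>k. \<epsilon> k \<in> {-1, 1::real}"
    "(\<Sum>k\<in>UNIV. (norm (X k))\<^sup>2) \<le> (norm (\<Sum>k\<in>UNIV. \<epsilon> k *\<^sub>R X k))\<^sup>2"
    using exists_signs_sum_norm_le[of UNIV X] by auto
  have pair: "(norm p)\<^sup>2 = (\<Sum>j\<in>UNIV. (cmod (fst p $ j))\<^sup>2 + (cmod (snd p $ j))\<^sup>2)"
    for p :: "(complex ^ 'm) \<times> (complex ^ 'm)"
    by (cases p) (simp add: norm_Pair norm_vec_power2 sum.distrib sum_nonneg)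
  have "?L = (\<Sum>k\<in>UNIV. \<Sum>j\<in>UNIV. ((cmod (?w k j))\<^sup>2 + (cmod (?v k j))\<^sup>2) * (?a k)\<^sup>2)"
    by (rule sum.swap)
  also have "\<dots> = (\<Sum>k\<in>UNIV. (norm (X k))\<^sup>2)"
    unfolding pair X_def by (simp add: power_mult_distrib distrib_left mult.commute)
  also have "\<dots> \<le> (norm (\<Sum>k\<in>UNIV. \<epsilon> k *\<^sub>R X k))\<^sup>2" by (rule \<epsilon>(2))
  also have "\<dots> = (\<Sum>j\<in>UNIV. (cmod (\<Sum>k\<in>UNIV. (\<epsilon> k * ?a k) *\<^sub>R ?w k j))\<^sup>2
       + (cmod (\<Sum>k\<in>UNIV. (\<epsilon> k * ?a k) *\<^sub>R ?v k j))\<^sup>2)"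
    unfolding pair by (simp add: X_def fst_sum snd_sum sum_component)
  also have "\<dots> \<le> 1 - (norm (f z))\<^sup>2"
    by (rule schwarz_pick_signed[OF ph ball z \<epsilon>(1)])
  finally show ?thesis .
qed

lemma sum_le_of_weighted_sum_le:
  fixes z :: "complex ^ 'n" and s :: "'m::finite \<Rightarrow> 'n \<Rightarrow> real"
  assumes z: "z \<in> polydisc" and s: "\<And>j k. s j k \<ge> 0"
    and le: "(\<Sum>j\<in>UNIV. \<Sum>k\<in>UNIV. s j k * (1 - (cmod (z $ k))\<^sup>2)\<^sup>2) \<le> R"
  shows "(\<Sum>j\<in>UNIV. \<Sum>k\<in>UNIV. s j k) \<le> R / (1 - (linf_norm z)\<^sup>2)\<^sup>2"
proof -
  have nz: "cmod (z $ k) \<le> linf_norm z" for k by (simp add: linf_norm_def)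
  then have "0 \<le> linf_norm z" using norm_ge_zero order_trans by blast
  moreover have "linf_norm z < 1" using z by (simp add: polydisc_def)
  ultimately have l: "(linf_norm z)\<^sup>2 < 1" by (simp add: abs_square_less_1)
  have "(1 - (linf_norm z)\<^sup>2)\<^sup>2 \<le> (1 - (cmod (z $ k))\<^sup>2)\<^sup>2" for k
    using l nz[of k] by (intro power_mono) (auto intro!: power_mono)
  then have "(\<Sum>j\<in>UNIV. \<Sum>k\<in>UNIV. s j k * (1 - (linf_norm z)\<^sup>2)\<^sup>2) \<le> R"
    by (intro order_trans[OF _ le] sum_mono mult_left_mono s)
  then have "(\<Sum>j\<in>UNIV. \<Sum>k\<in>UNIV. s j k) * (1 - (linf_norm z)\<^sup>2)\<^sup>2 \<le> R"
    by (simp add: sum_distrib_right)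
  then show ?thesis using l by (simp add: pos_le_divide_eq)
qed

section \<open>The extremal map\<close>

lemma open_polydisc: "open (polydisc :: (complex ^ 'n) set)"
proof -
  have "(polydisc :: (complex ^ 'n) set) = (\<Inter>k. {z. cmod (z $ k) < 1})"
    by (auto simp: mem_polydisc_iff)
  also have "open \<dots>" by (intro open_INT ballI open_Collect_less continuous_intros) auto
  finally show ?thesis .
qed

lemma convex_polydisc: "convex (polydisc :: (complex ^ 'n) set)"
proof -
  have "convex {z :: complex ^ 'n. cmod (z $ k) < 1}" for k
    using convex_linear_vimage[of "\<lambda>z :: complex ^ 'n. z $ k" "ball 0 1"]
    by (simp add: vimage_def linear_iff)
  then have "convex (\<Inter>k. {z :: complex ^ 'n. cmod (z $ k) < 1})" by (intro convex_INT)
  moreover have "(polydisc :: (complex ^ 'n) set) = (\<Inter>k. {z. cmod (z $ k) < 1})"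
    by (auto simp: mem_polydisc_iff)
  ultimately show ?thesis by simp
qed

lemma has_derivative_holomorphic_affine:
  assumes "F holomorphic_on T" "open T" "bounded_linear L" "L x + c \<in> T"
  shows "((\<lambda>x. F (L x + c)) has_derivative (\<lambda>v. deriv F (L x + c) * L v)) (at x)"
proof -
  have "((\<lambda>x. L x + c) has_derivative L) (at x)"
    using bounded_linear_imp_has_derivative[OF assms(3)] by (auto intro!: derivative_eq_intros)
  from has_derivative_compose[OF this holomorphic_derivI[OF assms(1,2,4), unfolded has_field_derivative_def]]
  show ?thesis .
qed

text \<open>\<open>J w\<close> is the real-linear map \<open>v \<mapsto> w * L v\<close>. As \<open>J\<close> is itself linear in \<open>w\<close>, the first derivative is
  \<open>J\<close> of \<open>F'\<close> and the second is \<open>J\<close> after \<open>J\<close> of \<open>F''\<close>.\<close>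

lemma C2_on_holomorphic_affine:
  fixes L :: "'a::real_normed_vector \<Rightarrow> complex"
  assumes F: "F holomorphic_on T" "open T" and L: "bounded_linear L"
    and S: "open S" "\<And>x. x \<in> S \<Longrightarrow> L x + c \<in> T"
  shows "C2_on (\<lambda>x. F (L x + c)) S"
proof -
  define B where "B = Blinfun L"
  have B: "blinfun_apply B = L" using L by (simp add: B_def bounded_linear_Blinfun_apply)
  define J where "J w = blinfun_mult_right w o\<^sub>L B" for w
  have J: "bounded_linear J"
    unfolding J_def by (intro bounded_linear_intros)
  define JB where "JB = Blinfun J"
  have JB: "blinfun_apply JB = J" using J by (simp add: JB_def bounded_linear_Blinfun_apply)
  have F': "deriv F holomorphic_on T" and F'': "deriv (deriv F) holomorphic_on T"
    using F holomorphic_deriv by auto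
  show ?thesis
    unfolding C2_on_def
  proof (intro conjI exI ballI)
    show "((\<lambda>x. F (L x + c)) has_derivative blinfun_apply (J (deriv F (L x + c)))) (at x)" if "x \<in> S" for x
      using has_derivative_holomorphic_affine[OF F L S(2)[OF that]]
      by (simp add: J_def B[symmetric] blinfun_compose.rep_eq comp_def)
    show "((\<lambda>x. J (deriv F (L x + c))) has_derivative
        blinfun_apply (JB o\<^sub>L J (deriv (deriv F) (L x + c)))) (at x)" if "x \<in> S" for x
      using bounded_linear.has_derivative[OF J has_derivative_holomorphic_affine[OF F' F(2) L S(2)[OF that]]]
      by (simp add: JB J_def B[symmetric] blinfun_compose.rep_eq comp_def)
    have "continuous_on S (\<lambda>x. deriv (deriv F) (L x + c))"
    proof (rule continuous_on_compose2[OF holomorphic_on_imp_continuous_on[OF F'']])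
      show "continuous_on S (\<lambda>x. L x + c)"
        by (intro continuous_on_add linear_continuous_on L continuous_on_const)
    qed (use S(2) in blast)
    then show "continuous_on S (\<lambda>x. JB o\<^sub>L J (deriv (deriv F) (L x + c)))"
      by (intro bounded_bilinear.continuous_on[OF bounded_bilinear_blinfun_compose]
          continuous_on_const bounded_linear.continuous_on[OF J])
  qed (rule S)
qed

text \<open>On a complex line the function becomes holomorphic in \<open>\<zeta>\<close>; its second derivative in direction \<open>v\<close>
  is \<open>v\<^sup>2\<close> times a number independent of \<open>v\<close>, and \<open>1\<^sup>2 + \<i>\<^sup>2 = 0\<close>.\<close>

lemma pluriharmonic_on_holomorphic_coordinate:
  fixes \<Omega> :: "(complex ^ 'n) set"
  assumes F: "F holomorphic_on T" "open T"
    and \<Omega>: "open \<Omega>" "connected \<Omega>" "\<Omega> \<noteq> {}" "\<And>z. z \<in> \<Omega> \<Longrightarrow> z $ k \<in> T"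
  shows "pluriharmonic_on (\<lambda>z. F (z $ k)) \<Omega>"
  unfolding pluriharmonic_on_def
proof (intro conjI ballI allI impI \<Omega>(1-3))
  show "C2_on (\<lambda>z. F (z $ k)) \<Omega>"
    using C2_on_holomorphic_affine[OF F bounded_linear_vec_nth \<Omega>(1), of k 0] \<Omega>(4) by simp
  fix z \<theta> :: "complex ^ 'n" assume z: "z \<in> \<Omega>" and \<theta>: "norm \<theta> = 1"
  define U where "U = {\<zeta>. ereal (cmod \<zeta>) < boundary_dist \<Omega> z}"
  have "open U"
    unfolding U_def by (intro open_Collect_less continuous_intros)
  define L where "L \<zeta> = \<zeta> * \<theta> $ k" for \<zeta>
  have L: "bounded_linear L" unfolding L_def by (rule bounded_linear_mult_left)
  have T: "L \<zeta> + z $ k \<in> T" if "\<zeta> \<in> U" for \<zeta>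
  proof -
    have "norm (\<zeta> *s \<theta>) = cmod \<zeta> * norm \<theta>"
      by (simp add: norm_vec_def L2_set_right_distrib norm_mult)
    then have "z + \<zeta> *s \<theta> \<in> \<Omega>"
      using that \<theta> by (intro boundary_dist_less_imp_mem[OF z]) (simp add: U_def dist_norm)
    then show ?thesis using \<Omega>(4) by (fastforce simp: L_def add.commute)
  qed
  have dd: "dir_deriv (\<lambda>\<zeta>. G (L \<zeta> + z $ k)) v \<zeta> = deriv G (L \<zeta> + z $ k) * L v"
    if "G holomorphic_on T" "\<zeta> \<in> U" for G v \<zeta>
    by (rule dir_deriv_eq[OF has_derivative_holomorphic_affine[OF that(1) F(2) L T[OF that(2)]]])
  have dd2: "dir_deriv (dir_deriv (\<lambda>\<zeta>. F (L \<zeta> + z $ k)) v) v \<zeta> = deriv (deriv F) (L \<zeta> + z $ k) * L v * L v"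
    if "\<zeta> \<in> U" for v \<zeta>
  proof -
    have "dir_deriv (dir_deriv (\<lambda>\<zeta>. F (L \<zeta> + z $ k)) v) v \<zeta>
        = dir_deriv (\<lambda>\<zeta>. (\<lambda>w. deriv F w * L v) (L \<zeta> + z $ k)) v \<zeta>"
      by (rule dir_deriv_cong[OF \<open>open U\<close> that]) (rule dd[OF F(1)])
    also have "\<dots> = deriv (\<lambda>w. deriv F w * L v) (L \<zeta> + z $ k) * L v"
      by (rule dd) (auto intro!: holomorphic_intros F that)
    also have "deriv (\<lambda>w. deriv F w * L v) (L \<zeta> + z $ k) = deriv (deriv F) (L \<zeta> + z $ k) * L v"
      using holomorphic_derivI[OF holomorphic_deriv[OF F] F(2) T[OF that]]
      by (intro DERIV_imp_deriv) (auto intro!: derivative_eq_intros)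
    finally show ?thesis .
  qed
  have "harmonic_on (\<lambda>\<zeta>. F (L \<zeta> + z $ k)) U"
    unfolding harmonic_on_def
  proof (intro conjI ballI)
    show "C2_on (\<lambda>\<zeta>. F (L \<zeta> + z $ k)) U"
      by (rule C2_on_holomorphic_affine[OF F L \<open>open U\<close> T])
    show "dir_deriv (dir_deriv (\<lambda>\<zeta>. F (L \<zeta> + z $ k)) 1) 1 \<zeta>
        + dir_deriv (dir_deriv (\<lambda>\<zeta>. F (L \<zeta> + z $ k)) \<i>) \<i> \<zeta> = 0" if "\<zeta> \<in> U" for \<zeta>
      unfolding dd2[OF that] by (simp add: L_def mult_ac)
  qed
  then show "harmonic_on (\<lambda>\<zeta>. F ((z + \<zeta> *s \<theta>) $ k)) {\<zeta>. ereal (cmod \<zeta>) < boundary_dist \<Omega> z}"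
    by (simp add: U_def L_def add.commute)
qed

lemma wirtinger_holomorphic_coordinate:
  assumes "F holomorphic_on T" "open T" "z $ l \<in> T"
  shows "wirtinger k (\<lambda>z. F (z $ l)) z = (if k = l then deriv F (z $ l) else 0)"
    and "wirtinger_bar k (\<lambda>z. F (z $ l)) z = 0"
proof -
  have "dir_deriv (\<lambda>z. F (z $ l)) v z = deriv F (z $ l) * v $ l" for v
    using dir_deriv_eq[OF has_derivative_holomorphic_affine[OF assms(1,2) bounded_linear_vec_nth, of z l 0]] assms(3)
    by simp
  then show "wirtinger k (\<lambda>z. F (z $ l)) z = (if k = l then deriv F (z $ l) else 0)"
    and "wirtinger_bar k (\<lambda>z. F (z $ l)) z = 0"
    by (auto simp: wirtinger_def wirtinger_bar_def axis_def algebra_simps)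
qed

lemma deriv_Moebius_function_at_its_zero:
  assumes "cmod a < 1"
  shows "deriv (Moebius_function 0 a) a = 1 / of_real (1 - (cmod a)\<^sup>2)"
proof -
  have "(cmod a)\<^sup>2 < 1" using assms by (simp add: abs_square_less_1)
  then have nz: "1 - cnj a * a \<noteq> 0"
    by (metis complex_norm_square less_irrefl mult.commute of_real_1 of_real_eq_iff right_minus_eq)
  have "of_real (1 - (cmod a)\<^sup>2) = 1 - cnj a * a"
    by (simp add: complex_norm_square mult.commute del: of_real_power)
  then show ?thesis
    unfolding Moebius_function_simple using nz
    by (intro DERIV_imp_deriv) (auto intro!: derivative_eq_intros simp: divide_simps)
qed

text \<open>The disc automorphism that sends \<open>z\<^sub>l\<close> to \<open>0\<close> has derivative \<open>1 / (1 - \<bar>z\<^sub>l\<bar>\<^sup>2)\<close> there. Placed in one component and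
  applied to one coordinate, it makes both sides equal to \<open>1\<close>.\<close>

lemma schwarz_pick_sharp:
  fixes z :: "complex ^ 'n"
  assumes z: "z \<in> polydisc"
  shows "\<exists>f :: complex ^ 'n \<Rightarrow> complex ^ 'm.
            pluriharmonic_map_on f polydisc \<and> f ` polydisc \<subseteq> ball 0 1 \<and>
            (\<Sum>j\<in>UNIV. \<Sum>k\<in>UNIV.
               ((cmod (wirtinger k (\<lambda>w. f w $ j) z))\<^sup>2
                + (cmod (wirtinger_bar k (\<lambda>w. f w $ j) z))\<^sup>2) * (1 - (cmod (z $ k))\<^sup>2)\<^sup>2)
              = 1 - (norm (f z))\<^sup>2"
proof -
  fix l :: 'n and i :: 'm
  define m where "m = Moebius_function 0 (z $ l)"
  define F where "F j = (if j = i then m else (\<lambda>_. 0))" for j :: 'm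
  define f :: "complex ^ 'n \<Rightarrow> complex ^ 'm" where "f w = axis i (m (w $ l))" for w
  have fj: "(\<lambda>w. f w $ j) = (\<lambda>w. F j (w $ l))" for j by (auto simp: f_def F_def axis_def)
  have zl: "cmod (z $ l) < 1" using z by (simp add: mem_polydisc_iff)
  have hol: "F j holomorphic_on ball 0 1" for j
    using Moebius_function_holomorphic[OF zl] by (simp add: F_def m_def)
  have dom: "w $ l \<in> ball 0 1" if "w \<in> polydisc" for w :: "complex ^ 'n"
    using that by (simp add: mem_polydisc_iff)
  have norm_axis: "norm (axis i c :: complex ^ 'm) = cmod c" for c
  proof -
    have "(\<Sum>j\<in>UNIV. (cmod ((axis i c :: complex ^ 'm) $ j))\<^sup>2) = (\<Sum>j\<in>UNIV. if j = i then (cmod c)\<^sup>2 else 0)"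
      by (intro sum.cong) (auto simp: axis_def)
    then show ?thesis by (simp add: norm_vec_def L2_set_def)
  qed
  have "pluriharmonic_map_on f polydisc"
    unfolding pluriharmonic_map_on_def fj
    using z by (intro allI pluriharmonic_on_holomorphic_coordinate[OF hol open_ball] open_polydisc
      convex_connected convex_polydisc dom) auto
  moreover have "f ` polydisc \<subseteq> ball 0 1"
    using Moebius_function_norm_lt_1[OF zl] dom by (auto simp: f_def m_def norm_axis)
  moreover have "(\<Sum>j\<in>UNIV. \<Sum>k\<in>UNIV.
               ((cmod (wirtinger k (\<lambda>w. f w $ j) z))\<^sup>2
                + (cmod (wirtinger_bar k (\<lambda>w. f w $ j) z))\<^sup>2) * (1 - (cmod (z $ k))\<^sup>2)\<^sup>2)
              = 1 - (norm (f z))\<^sup>2"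
  proof -
    have "f z = 0" by (simp add: f_def m_def Moebius_function_eq_zero vec_eq_iff axis_def)
    have "(cmod (z $ l))\<^sup>2 < 1" using zl by (simp add: abs_square_less_1)
    then have "cmod (deriv m (z $ l)) * (1 - (cmod (z $ l))\<^sup>2) = 1"
      unfolding m_def deriv_Moebius_function_at_its_zero[OF zl] norm_divide norm_of_real by simp
    then have one: "(cmod (deriv m (z $ l)))\<^sup>2 * (1 - (cmod (z $ l))\<^sup>2)\<^sup>2 = 1"
      by (metis power_mult_distrib power_one)
    have "((cmod (wirtinger k (\<lambda>w. f w $ j) z))\<^sup>2
         + (cmod (wirtinger_bar k (\<lambda>w. f w $ j) z))\<^sup>2) * (1 - (cmod (z $ k))\<^sup>2)\<^sup>2
       = (if j = i then if k = l then 1 else 0 else 0)" for j k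
      unfolding fj wirtinger_holomorphic_coordinate[OF hol open_ball dom[OF z]]
      using one by (simp add: F_def)
    moreover have "(\<Sum>k\<in>UNIV. if j = i then if k = l then 1 else 0 else 0) = (if j = i then 1 else 0 :: real)" for j
      by simp
    ultimately show ?thesis using \<open>f z = 0\<close> by simp
  qed
  ultimately show ?thesis by blast
qed

theorem theorem2p4:
  shows "(\<forall>f :: complex ^ 'n \<Rightarrow> complex ^ 'm.
            pluriharmonic_map_on f polydisc \<and> f ` polydisc \<subseteq> ball 0 1 \<longrightarrow>
            (\<forall>z\<in>polydisc.
               (\<Sum>j\<in>UNIV. \<Sum>k\<in>UNIV.
                  ((cmod (wirtinger k (\<lambda>w. f w $ j) z))\<^sup>2
                   + (cmod (wirtinger_bar k (\<lambda>w. f w $ j) z))\<^sup>2) * (1 - (cmod (z $ k))\<^sup>2)\<^sup>2)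
                 \<le> 1 - (norm (f z))\<^sup>2 \<and>
               (\<Sum>j\<in>UNIV. \<Sum>k\<in>UNIV.
                  ((cmod (wirtinger k (\<lambda>w. f w $ j) z))\<^sup>2
                   + (cmod (wirtinger_bar k (\<lambda>w. f w $ j) z))\<^sup>2))
                 \<le> (1 - (norm (f z))\<^sup>2) / (1 - (linf_norm z)\<^sup>2)\<^sup>2)) \<and>
         (\<forall>z\<in>polydisc. \<exists>f :: complex ^ 'n \<Rightarrow> complex ^ 'm.
            pluriharmonic_map_on f polydisc \<and> f ` polydisc \<subseteq> ball 0 1 \<and>
            (\<Sum>j\<in>UNIV. \<Sum>k\<in>UNIV.
               ((cmod (wirtinger k (\<lambda>w. f w $ j) z))\<^sup>2
                + (cmod (wirtinger_bar k (\<lambda>w. f w $ j) z))\<^sup>2) * (1 - (cmod (z $ k))\<^sup>2)\<^sup>2)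
              = 1 - (norm (f z))\<^sup>2)"
proof (intro conjI allI ballI impI)
  fix f :: "complex ^ 'n \<Rightarrow> complex ^ 'm" and z :: "complex ^ 'n"
  assume f: "pluriharmonic_map_on f polydisc \<and> f ` polydisc \<subseteq> ball 0 1" and z: "z \<in> polydisc"
  show weighted: "(\<Sum>j\<in>UNIV. \<Sum>k\<in>UNIV.
                  ((cmod (wirtinger k (\<lambda>w. f w $ j) z))\<^sup>2
                   + (cmod (wirtinger_bar k (\<lambda>w. f w $ j) z))\<^sup>2) * (1 - (cmod (z $ k))\<^sup>2)\<^sup>2)
                 \<le> 1 - (norm (f z))\<^sup>2"
    using f z by (blast intro: schwarz_pick_weighted)
  show "(\<Sum>j\<in>UNIV. \<Sum>k\<in>UNIV.
                  ((cmod (wirtinger k (\<lambda>w. f w $ j) z))\<^sup>2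
                   + (cmod (wirtinger_bar k (\<lambda>w. f w $ j) z))\<^sup>2))
                 \<le> (1 - (norm (f z))\<^sup>2) / (1 - (linf_norm z)\<^sup>2)\<^sup>2"
    by (rule sum_le_of_weighted_sum_le[OF z _ weighted]) simp
qed (rule schwarz_pick_sharp)

end
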